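(* Let $m=\inf_{n\ge0}f(n)$ and $M=\sup_{n\ge0}f(n)$, where $f(n)=a(n)-cn$. For every integer $K\ge5$ and every rational bracket $\alpha<c<\beta$, the suffix construction described in the context provides rational enclosures $$L_K-R_K\le m\le u_-,\qquad \ell_+\le M\le V_K+R_K,$$ each of width at most $$2R_K+(\beta-\alpha)\,(U_K+U_{K+H}),\qquad H=13.$$ Choosing $\beta-\alpha=2^{-4K-64}$ gives widths tending to zero as $K\to\infty$.
   Context: **Sequence and constant.** $a(0)=0$, $a(1)=1$, $a(n)=n-a(n-a(n-a(n-1)))$ for $n\ge2$ (this defines a unique sequence of nonnegative integers). $c$ is the real root of $t^3-t^2+2t-1$. **Weights.** $U_0,U_1,U_2,U_3,U_4=1,2,3,4,5$ and $U_p=U_{p-2}+U_{p-3}$ for $p\ge4$. For a binary word $w=w_k\cdots w_0$ (most significant digit first), $\operatorname{val}(w)=\sum_p w_pU_p$. **Language $G$.** $G$ is the set of greedy representations with arbitrary leading zeros (including the empty word), where the greedy representation of $n$ repeatedly selects the largest weight not exceeding the current remainder. It is recognized by the partial automaton with states $0,1,2,3,4,t$, all accepting, initial state $0$, where a numerical state is the number of zeros still required before the next $1$: from $0$, digit $0$ leads to $0$ and digit $1$ leads to $4$; from $j\in\{1,2,3,4\}$, digit $0$ leads to $j-1$; from $1$, digit $1$ leads to the terminal state $t$ (an exceptional final $1$); no other transitions. **Correction automaton $E$.** States $0,\dots,27$, initial state $0$, reading most significant digit first; $E(w)$ is the output of the state reached on $w$. Written as state:(successor on 0, successor on 1, output),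 with a dash for an undefined transition: 0:(0,1,0); 1:(2,–,1); 2:(3,–,1); 3:(4,–,1); 4:(5,6,0); 5:(7,8,0); 6:(–,–,1); 7:(9,10,0); 8:(11,–,0); 9:(5,12,0); 10:(13,–,1); 11:(14,–,2); 12:(15,–,1); 13:(16,–,1); 14:(17,–,0); 15:(18,–,1); 16:(19,–,1); 17:(20,21,1); 18:(22,–,1); 19:(23,21,1); 20:(24,1,0); 21:(–,–,0); 22:(9,6,0); 23:(25,10,−1); 24:(26,1,0); 25:(20,27,1); 26:(23,8,1); 27:(15,–,0). **Tail bound.** $R_K=\dfrac{(5/16)(7/8)^{K-3}}{1-(7/8)^5}$ for $K\ge5$. **Suffix construction.** There are $28$ pairs (state of $E$, state of the automaton for $G$) reachable by reading words of $G$ from the initial pair; for each such pair a reaching prefix $p$ of length at most $H=13$ is fixed (found by breadth-first search). For each reachable pair with fixed prefix $p$, and each binary word $s=s_{K-1}\cdots s_0$ of length $K$ with $ps\in G$ (a legal path of length $K$ from the pair), the contribution of the last $K$ digits, including the final output of $E$, is $A-cB$ with $$A=E(ps)+\sum_{2\le j<K}s_jU_{j-2}\in\mathbb Z,\qquad B=\sum_{0\le j<K}s_jU_j,\quad 0\le B<U_K.$$ Over all reachable pairs and all such $s$, put $$L_K=\min(A-\beta B),\qquad V_K=\max(A-\alpha B).$$ Choose a pair and suffix attaining $L_K$ and let $n_-=\operatorname{val}(ps)$ for the corresponding word $ps$; choose a pair and suffix attaining $V_K$ and let $n_+=\operatorname{val}(ps)$ for the corresponding word. Put $$u_-=a(n_-)-\alpha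 n_-,\qquad \ell_+=a(n_+)-\beta n_+,$$ the upper endpoint of the enclosure of $f(n_-)$ and the lower endpoint of the enclosure of $f(n_+)$ given by the bracket. *)

theory Defs
  imports Complex_Main
begin

function seq_a :: "nat \<Rightarrow> nat" where
  "seq_a 0 = 0"
| "seq_a (Suc 0) = 1"
| "seq_a (Suc (Suc n)) =
     Suc (Suc n) - seq_a (Suc (Suc n) - seq_a (Suc (Suc n) - seq_a (Suc n)))"
  by pat_completeness auto

lemma seq_a_dom_bounds:
  assumes "seq_a_dom n"
  shows "seq_a n \<le> n \<and> (n > 0 \<longrightarrow> seq_a n > 0)"
  using assms
proof (induction rule: seq_a.pinduct)
  case (3 n)
  let ?N = "Suc (Suc n)"
  have 1: "seq_a (Suc n) \<le> Suc n" "seq_a (Suc n) > 0"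
    using 3 by auto
  have 2: "seq_a (?N - seq_a (Suc n)) > 0"
          "seq_a (?N - seq_a (Suc n)) \<le> ?N - seq_a (Suc n)"
    using 3 1 by auto
  define k where "k = ?N - seq_a (?N - seq_a (Suc n))"
  have k: "0 < k" "k < ?N"
    using 1 2 unfolding k_def by linarith+
  have 3: "seq_a k > 0 \<and> seq_a k \<le> k"
    using "3.IH"(3) k unfolding k_def by auto
  have "seq_a ?N = ?N - seq_a k"
    unfolding k_def by (rule seq_a.psimps(3)) (fact "3.hyps")
  then show ?case using 3 k by linarith
qed (auto simp: seq_a.psimps)

termination seq_a
proof (relation "measure id", goal_cases)
  case (3 n)
  then show ?case using seq_a_dom_bounds[of "Suc n"] by simp
next
  case (4 n)
  have "seq_a (Suc n) \<le> Suc n" using 4 seq_a_dom_bounds by blast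
  then have "Suc (Suc n) - seq_a (Suc n) > 0" by simp
  then have "seq_a (Suc (Suc n) - seq_a (Suc n)) > 0"
    using 4(2) seq_a_dom_bounds by blast
  then show ?case by simp
qed simp_all

lemma seq_a_rec:
  "n \<ge> 2 \<Longrightarrow> seq_a n = n - seq_a (n - seq_a (n - seq_a (n - 1)))"
  by (cases n rule: seq_a.cases) auto

definition const_c :: real where
  "const_c = (THE t. t ^ 3 - t ^ 2 + 2 * t - 1 = 0)"

definition f :: "nat \<Rightarrow> real" where
  "f n = real (seq_a n) - const_c * real n"

fun U :: "nat \<Rightarrow> nat" where
  "U 0 = 1"
| "U (Suc 0) = 2"
| "U (Suc (Suc 0)) = 3"
| "U (Suc (Suc (Suc 0))) = 4"
| "U (Suc (Suc (Suc (Suc p)))) = U (Suc (Suc p)) + U (Suc p)"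

lemma U_pos: "U p > 0"
  by (induction p rule: U.induct) auto

text \<open>Binary words are lists of booleans, most significant digit first;
  \<open>digit w p\<close> is the digit of weight \<open>U p\<close>, for \<open>p < length w\<close>.\<close>

definition digit :: "bool list \<Rightarrow> nat \<Rightarrow> bool" where
  "digit w p = rev w ! p"

definition val :: "bool list \<Rightarrow> nat" where
  "val w = (\<Sum>p<length w. of_bool (digit w p) * U p)"

function greedy_positions :: "nat \<Rightarrow> nat list" where
  "greedy_positions n =
     (if n = 0 then []
      else let p = (GREATEST p. U p \<le> n) in p # greedy_positions (n - U p))"
  by auto
termination by (relation "measure id") (auto simp: U_pos)

declare greedy_positions.simps [simp del]

text \<open>No position is selected twice, because \<open>U (Suc p) \<le> 2 * U p\<close>.\<close>

definition greedy_word :: "nat \<Rightarrow> bool list" where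
  "greedy_word n =
     (if n = 0 then []
      else map (\<lambda>p. p \<in> set (greedy_positions n)) (rev [0..<Suc (hd (greedy_positions n))]))"

definition G :: "bool list set" where
  "G = {replicate z False @ greedy_word n | z n. True}"

fun run :: "('q \<Rightarrow> bool \<Rightarrow> 'q option) \<Rightarrow> 'q \<Rightarrow> bool list \<Rightarrow> 'q option" where
  "run \<delta> q [] = Some q"
| "run \<delta> q (b # w) = Option.bind (\<delta> q b) (\<lambda>q'. run \<delta> q' w)"

text \<open>\<open>Wj\<close>: \<open>j\<close> zeros are still required before the next one; \<open>Term\<close> is reached by
  an exceptional final one.\<close>

datatype gstate = W0 | W1 | W2 | W3 | W4 | Term

fun g_step :: "gstate \<Rightarrow> bool \<Rightarrow> gstate option" where
  "g_step W0 False = Some W0"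
| "g_step W0 True = Some W4"
| "g_step W1 False = Some W0"
| "g_step W1 True = Some Term"
| "g_step W2 False = Some W1"
| "g_step W3 False = Some W2"
| "g_step W4 False = Some W3"
| "g_step _ _ = None"

text \<open>Entry \<open>q\<close> consists of the successors of state \<open>q\<close> on 0 and on 1 and the output of \<open>q\<close>.\<close>

definition e_table :: "(nat option \<times> nat option \<times> int) list" where
  "e_table =
    [(Some 0, Some 1, 0),    (Some 2, None, 1),     (Some 3, None, 1),     (Some 4, None, 1),
     (Some 5, Some 6, 0),    (Some 7, Some 8, 0),   (None, None, 1),       (Some 9, Some 10, 0),
     (Some 11, None, 0),     (Some 5, Some 12, 0),  (Some 13, None, 1),    (Some 14, None, 2),
     (Some 15, None, 1),     (Some 16, None, 1),    (Some 17, None, 0),    (Some 18, None, 1),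
     (Some 19, None, 1),     (Some 20, Some 21, 1), (Some 22, None, 1),    (Some 23, Some 21, 1),
     (Some 24, Some 1, 0),   (None, None, 0),       (Some 9, Some 6, 0),   (Some 25, Some 10, -1),
     (Some 26, Some 1, 0),   (Some 20, Some 27, 1), (Some 23, Some 8, 1),  (Some 15, None, 0)]"

definition e_step :: "nat \<Rightarrow> bool \<Rightarrow> nat option" where
  "e_step q b = (if b then fst (snd (e_table ! q)) else fst (e_table ! q))"

text \<open>The run is defined on all words of \<open>G\<close>, the only words to which \<open>E_out\<close> is applied below.\<close>

definition E_out :: "bool list \<Rightarrow> int" where
  "E_out w = snd (snd (e_table ! the (run e_step 0 w)))"

definition R :: "nat \<Rightarrow> rat" where
  "R K = (5 / 16) * (7 / 8) ^ (K - 3) / (1 - (7 / 8) ^ 5)"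

definition reaches :: "bool list \<Rightarrow> nat \<times> gstate \<Rightarrow> bool" where
  "reaches w x \<longleftrightarrow> run e_step 0 w = Some (fst x) \<and> run g_step W0 w = Some (snd x)"

definition reachable_pairs :: "(nat \<times> gstate) set" where
  "reachable_pairs = {x. \<exists>w\<in>G. reaches w x}"

definition H :: nat where "H = 13"

text \<open>A choice of one reaching prefix for every reachable pair. The prefixes found by
  breadth-first search are one such choice.\<close>

definition prefix_choice :: "(nat \<times> gstate \<Rightarrow> bool list) \<Rightarrow> bool" where
  "prefix_choice pre \<longleftrightarrow>
     (\<forall>x\<in>reachable_pairs. pre x \<in> G \<and> reaches (pre x) x \<and> length (pre x) \<le> H)"

definition legal_suffixes ::
  "(nat \<times> gstate \<Rightarrow> bool list) \<Rightarrow> nat \<Rightarrow> ((nat \<times> gstate) \<times> bool list) set" where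
  "legal_suffixes pre K =
     {(x, s). x \<in> reachable_pairs \<and> length s = K \<and> pre x @ s \<in> G}"

definition A_part :: "bool list \<Rightarrow> bool list \<Rightarrow> int" where
  "A_part p s = E_out (p @ s) + (\<Sum>j\<in>{2..<length s}. of_bool (digit s j) * int (U (j - 2)))"

definition B_part :: "bool list \<Rightarrow> nat" where
  "B_part s = (\<Sum>j\<in>{0..<length s}. of_bool (digit s j) * U j)"

text \<open>The contribution \<open>A - \<gamma> B\<close> of a suffix, with a rational \<open>\<gamma>\<close> in place of \<open>c\<close>.\<close>

definition contribution ::
  "(nat \<times> gstate \<Rightarrow> bool list) \<Rightarrow> rat \<Rightarrow> (nat \<times> gstate) \<times> bool list \<Rightarrow> rat" where
  "contribution pre \<gamma> = (\<lambda>(x, s). of_int (A_part (pre x) s) - \<gamma> * of_nat (B_part s))"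

definition L :: "(nat \<times> gstate \<Rightarrow> bool list) \<Rightarrow> nat \<Rightarrow> rat \<Rightarrow> rat" where
  "L pre K \<beta> = Min (contribution pre \<beta> ` legal_suffixes pre K)"

definition V :: "(nat \<times> gstate \<Rightarrow> bool list) \<Rightarrow> nat \<Rightarrow> rat \<Rightarrow> rat" where
  "V pre K \<alpha> = Max (contribution pre \<alpha> ` legal_suffixes pre K)"

definition attains_L ::
  "(nat \<times> gstate \<Rightarrow> bool list) \<Rightarrow> nat \<Rightarrow> rat \<Rightarrow> (nat \<times> gstate) \<times> bool list \<Rightarrow> bool" where
  "attains_L pre K \<beta> y \<longleftrightarrow> y \<in> legal_suffixes pre K \<and> contribution pre \<beta> y = L pre K \<beta>"

definition attains_V ::
  "(nat \<times> gstate \<Rightarrow> bool list) \<Rightarrow> nat \<Rightarrow> rat \<Rightarrow> (nat \<times> gstate) \<times> bool list \<Rightarrow> bool" where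
  "attains_V pre K \<alpha> y \<longleftrightarrow> y \<in> legal_suffixes pre K \<and> contribution pre \<alpha> y = V pre K \<alpha>"

definition n_of :: "(nat \<times> gstate \<Rightarrow> bool list) \<Rightarrow> (nat \<times> gstate) \<times> bool list \<Rightarrow> nat" where
  "n_of pre = (\<lambda>(x, s). val (pre x @ s))"

definition u_minus ::
  "(nat \<times> gstate \<Rightarrow> bool list) \<Rightarrow> rat \<Rightarrow> (nat \<times> gstate) \<times> bool list \<Rightarrow> rat" where
  "u_minus pre \<alpha> y = of_nat (seq_a (n_of pre y)) - \<alpha> * of_nat (n_of pre y)"

definition l_plus ::
  "(nat \<times> gstate \<Rightarrow> bool list) \<Rightarrow> rat \<Rightarrow> (nat \<times> gstate) \<times> bool list \<Rightarrow> rat" where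
  "l_plus pre \<beta> y = of_nat (seq_a (n_of pre y)) - \<beta> * of_nat (n_of pre y)"

definition bracket :: "rat \<Rightarrow> rat \<Rightarrow> bool" where
  "bracket \<alpha> \<beta> \<longleftrightarrow> of_rat \<alpha> < const_c \<and> const_c < of_rat \<beta>"

definition width_bound :: "nat \<Rightarrow> rat \<Rightarrow> rat \<Rightarrow> rat" where
  "width_bound K \<alpha> \<beta> = 2 * R K + (\<beta> - \<alpha>) * of_nat (U K + U (K + H))"

end

theory Submission
  imports Defs
begin

text \<open>
  The tail estimates are elementary once \<open>a\<close> is known to be computed by the correction automaton,
  i.e. \<open>a (val w)\<close> is the value of \<open>w\<close> shifted by two places plus \<open>E w\<close>. This is proved by induction
  along the recursion. Two more corrections, tracked by a refinement of \<open>E\<close> with 43 states, describe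
  \<open>n - a(n-1)\<close> and \<open>n - a(n - a(n-1))\<close> as shifts of the representation of \<open>n\<close> by three places and
  one place. Each of the three resulting identities relates two representations, \<open>X\<close> of some argument
  and \<open>N\<close> of \<open>n\<close>. Reading both in parallel, the difference of \<open>X\<close> and the shifted \<open>N\<close> is an element of
  \<open>\<int>[\<rho>]\<close>, \<open>\<rho>\<close> the plastic number; it stays in a finite set or becomes too large to be compensated
  by the remaining digits. So each identity is checked on finitely many states.

  For the tail, \<open>U (j - 2) - c U j\<close> lies in the contracting plane of the recursion, where a
  positive definite quadratic form is multiplied by \<open>1/\<rho> < (7/8)\<^sup>2\<close> in each step, and ones in a
  greedy representation are at least five places apart, except at the final digit.
\<close>

section \<open>Digit sums\<close>

text \<open>The weight is a parameter because digits get summed against \<open>U\<close>,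
  \<open>pad\<close> and its shifts, indicators of low places, and
  \<open>shift_error\<close>.\<close>

definition wsum :: "(nat \<Rightarrow> 'a::comm_semiring_1) \<Rightarrow> bool list \<Rightarrow> 'a" where
  "wsum g w = (\<Sum>i<length w. of_bool (digit w i) * g i)"

lemma wsum_Nil [simp]: "wsum g [] = 0"
  by (simp add: wsum_def)

lemma wsum_snoc: "wsum g (w @ [d]) = of_bool d * g 0 + wsum (\<lambda>i. g (Suc i)) w"
  unfolding wsum_def length_append_singleton sum.lessThan_Suc_shift
  by (simp add: digit_def)

lemma wsum_append: "wsum g (p @ s) = wsum (\<lambda>i. g (i + length s)) p + wsum g s"
proof (induction s arbitrary: g rule: rev_induct)
  case (snoc d s)
  have "wsum g (p @ s @ [d]) = of_bool d * g 0 + wsum (\<lambda>i. g (Suc i)) (p @ s)"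
    using wsum_snoc[of g "p @ s" d] by simp
  also have "\<dots> = wsum (\<lambda>i. g (Suc (i + length s))) p + (of_bool d * g 0 + wsum (\<lambda>i. g (Suc i)) s)"
    by (simp add: snoc ac_simps)
  finally show ?case by (simp add: wsum_snoc)
qed simp

lemma wsum_Cons: "wsum g (b # w) = of_bool b * g (length w) + wsum g w"
proof -
  have "wsum g ([b] @ w) = of_bool b * g (length w) + wsum g w"
    unfolding wsum_append using wsum_snoc[of "\<lambda>i. g (i + length w)" "[]" b] by simp
  then show ?thesis by simp
qed

lemma wsum_replicate_False [simp]: "wsum g (replicate n False) = 0"
  by (induction n) (simp_all add: wsum_Cons)

lemma wsum_add: "wsum (\<lambda>i. g i + h i) w = wsum g w + wsum h w"
  by (simp add: wsum_def algebra_simps sum.distrib)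

lemma wsum_of_nat: "wsum (\<lambda>i. of_nat (g i)) w = of_nat (wsum g w)"
  by (simp add: wsum_def)

lemma wsum_of_int: "wsum (\<lambda>i. of_int (g i)) w = of_int (wsum g w)"
  by (simp add: wsum_def)

lemma wsum_diff: "wsum (\<lambda>i. g i - h i :: 'a :: comm_ring_1) w = wsum g w - wsum h w"
  by (simp add: wsum_def algebra_simps sum_subtractf)

lemma wsum_scale: "wsum (\<lambda>i. a * g i) w = a * wsum g w"
  unfolding wsum_def sum_distrib_left by (intro sum.cong) (auto simp: ac_simps)

lemma wsum_cong: "(\<And>i. i < length w \<Longrightarrow> g i = h i) \<Longrightarrow> wsum g w = wsum h w"
  by (simp add: wsum_def)

lemma val_wsum: "val w = wsum U w"
  by (simp add: val_def wsum_def)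

text \<open>Padovan numbers, shifted so that \<open>U\<close> becomes regular: \<open>pad (p + 2)\<close> is \<open>U p\<close>,
  except for \<open>pad 2 = 2\<close>.\<close>

fun pad :: "nat \<Rightarrow> int" where
  "pad 0 = 1"
| "pad (Suc 0) = 1"
| "pad (Suc (Suc 0)) = 2"
| "pad (Suc (Suc (Suc n))) = pad (Suc n) + pad n"

lemma U_pad: "int (U p) = pad (p + 2) - of_bool (p < 1)"
  by (induction p rule: U.induct) auto

lemma val_pad: "int (val w) = wsum (\<lambda>i. pad (i + 2)) w - wsum (\<lambda>i. of_bool (i < 1)) w"
  by (simp add: val_wsum wsum_of_nat[symmetric] U_pad wsum_diff)

text \<open>The correction cancels \<open>pad\<close> at places 0 and 1, which the left sum omits,
  and turns \<open>pad 2 = 2\<close> into \<open>U 0 = 1\<close> at place 2.\<close>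

lemma shifted_val_pad:
  "(\<Sum>j\<in>{2..<length w}. of_bool (digit w j) * int (U (j - 2))) =
     wsum pad w - wsum (\<lambda>i. of_bool (i < 3)) w"
proof -
  have *: "pad j - of_bool (j < 3) = (if 2 \<le> j then int (U (j - 2)) else 0)" for j
  proof (cases "2 \<le> j")
    case True
    then obtain i where "j = i + 2" by (metis add.commute le_Suc_ex)
    then show ?thesis by (auto simp: U_pad)
  next
    case False
    then have "j = 0 \<or> j = 1" by auto
    then show ?thesis by auto
  qed
  have "wsum pad w - wsum (\<lambda>i. of_bool (i < 3)) w = wsum (\<lambda>j. pad j - of_bool (j < 3)) w"
    by (simp add: wsum_diff)
  also have "\<dots> = (\<Sum>j<length w. if 2 \<le> j then of_bool (digit w j) * int (U (j - 2)) else 0)"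
    unfolding * wsum_def by (intro sum.cong) auto
  also have "\<dots> = (\<Sum>j\<in>{2..<length w}. of_bool (digit w j) * int (U (j - 2)))"
    by (rule sum.mono_neutral_cong_right) auto
  finally show ?thesis by simp
qed

section \<open>Automata\<close>

lemma run_append: "run \<delta> q (u @ v) = Option.bind (run \<delta> q u) (\<lambda>q'. run \<delta> q' v)"
  by (induction u arbitrary: q) (auto split: bind_splits)

lemma run_snoc: "run \<delta> q (w @ [d]) = Option.bind (run \<delta> q w) (\<lambda>q'. \<delta> q' d)"
  by (auto simp: run_append split: bind_splits)

text \<open>The number of ones among the last digit and among the last three digits, read off
  the state. They account for the difference between \<open>U\<close> and \<open>pad\<close> at small positions.\<close>

fun last_one :: "gstate \<Rightarrow> int" where
  "last_one W4 = 1"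
| "last_one Term = 1"
| "last_one _ = 0"

fun last_three :: "gstate \<Rightarrow> int" where
  "last_three W0 = 0"
| "last_three W1 = 0"
| "last_three _ = 1"

lemma g_step_cases:
  assumes "g_step g d = Some g'"
  obtains "g = W0" "\<not> d" "g' = W0" | "g = W0" "d" "g' = W4" | "g = W1" "\<not> d" "g' = W0"
    | "g = W1" "d" "g' = Term" | "g = W2" "\<not> d" "g' = W1" | "g = W3" "\<not> d" "g' = W2"
    | "g = W4" "\<not> d" "g' = W3"
  using assms by (cases g; cases d) auto

lemma last_digits:
  assumes "run g_step W0 w = Some g"
  shows "wsum (\<lambda>i. of_bool (i < 1)) w = last_one g"
    and "wsum (\<lambda>i. of_bool (i < 3)) w = last_three g"
proof -
  \<comment> \<open>The count over two digits serves the induction: the last three digits of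
    \<open>w @ [d]\<close> are \<open>d\<close> and the last two of \<open>w\<close>.\<close>
  have "wsum (\<lambda>i. of_bool (i < 1)) w = last_one g \<and>
     wsum (\<lambda>i. of_bool (i < 2)) w = (of_bool (g \<in> {W3, W4, Term}) :: int) \<and>
     wsum (\<lambda>i. of_bool (i < 3)) w = last_three g"
    using assms
  proof (induction w arbitrary: g rule: rev_induct)
    case (snoc d w)
    then obtain g0 where g0: "run g_step W0 w = Some g0" and st: "g_step g0 d = Some g"
      by (auto simp: run_snoc split: bind_splits)
    have z: "wsum (\<lambda>i. 0) w = (0::int)" by (simp add: wsum_def)
    from st snoc.IH[OF g0] show ?case
      by (cases rule: g_step_cases) (simp_all add: wsum_snoc z numeral_2_eq_2 numeral_3_eq_3)
  qed simp
  then show "wsum (\<lambda>i. of_bool (i < 1)) w = last_one g"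
    and "wsum (\<lambda>i. of_bool (i < 3)) w = last_three g" by auto
qed

text \<open>A state of \<open>E\<close> determines the state of the automaton for \<open>G\<close>;
  this is why there are only 28 reachable pairs.\<close>

definition e_gstate :: "gstate list" where
  "e_gstate =
    [W0, W4, W3, W2, W1, W0, Term, W0, W4, W0, W4, W3, W4, W3,
     W2, W3, W2, W1, W2, W1, W0, Term, W1, W0, W0, W0, W0, W4]"

text \<open>Adjusted by the error in \<open>shifted_val_pad\<close>, so that the shift by two places
  can use the regular weights \<open>pad\<close>.\<close>

definition e_corr :: "nat \<Rightarrow> int" where
  "e_corr x = snd (snd (e_table ! x)) - last_three (e_gstate ! x)"

text \<open>A refinement of \<open>E\<close>. Besides the successors and the underlying state of \<open>E\<close>, an entry
  contains the corrections to the shifts by three and by one place of the representation of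
  \<open>n\<close> that produce \<open>n - a(n-1)\<close> and \<open>n - a(n - a(n-1))\<close>. It was found by merging words whose
  continuations have the same corrections.\<close>

definition m_table :: "(nat option \<times> nat option \<times> nat \<times> int \<times> int) list" where
  "m_table =
    [(Some 0, Some 1, 0, 0, 0), (Some 2, None, 1, 0, -1), (Some 3, None, 2, 0, -1),
     (Some 4, None, 3, 1, 0), (Some 5, Some 6, 4, 0, 0), (Some 7, Some 8, 5, 1, -1),
     (None, None, 6, 0, -1), (Some 9, Some 10, 7, 0, 0), (Some 11, None, 8, 0, 0),
     (Some 12, Some 13, 9, 1, -1), (Some 14, None, 10, 0, -1), (Some 15, None, 11, 0, -1),
     (Some 16, Some 8, 5, 0, 0), (Some 17, None, 12, 0, -1), (Some 18, None, 13, 0, -1),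
     (Some 19, None, 14, 1, 0), (Some 20, Some 10, 7, 1, 0), (Some 21, None, 15, 1, -1),
     (Some 22, None, 16, 1, 0), (Some 23, Some 24, 17, 0, 0), (Some 5, Some 13, 9, 0, 0),
     (Some 25, None, 18, 0, 0), (Some 26, Some 27, 19, 0, -1), (Some 28, Some 29, 20, 0, -1),
     (None, None, 21, 0, -1), (Some 20, Some 6, 22, 1, 0), (Some 30, Some 31, 23, 1, 0),
     (None, None, 21, 1, -1), (Some 32, Some 33, 24, 1, 0), (Some 2, None, 1, 0, 0),
     (Some 23, Some 34, 25, 0, 0), (Some 35, None, 10, -1, 0), (Some 26, Some 36, 26, 0, -1),
     (Some 37, None, 1, -1, -1), (Some 38, None, 27, 0, -1), (Some 18, None, 13, 1, -1),
     (Some 11, None, 8, 1, -1), (Some 39, None, 2, 1, -1), (Some 40, None, 15, 0, 0),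
     (Some 41, None, 3, 0, 0), (Some 42, None, 18, 1, -1), (Some 12, Some 6, 4, 1, -1),
     (Some 9, Some 6, 22, 0, 0)]"

definition m_step :: "nat \<Rightarrow> bool \<Rightarrow> nat option" where
  "m_step n d = (case m_table ! n of (s0, s1, _) \<Rightarrow> if d then s1 else s0)"

definition m_e :: "nat \<Rightarrow> nat" where
  "m_e n = fst (snd (snd (m_table ! n)))"

definition m_corr3 :: "nat \<Rightarrow> int" where
  "m_corr3 n = fst (snd (snd (snd (m_table ! n))))"

definition m_corr1 :: "nat \<Rightarrow> int" where
  "m_corr1 n = snd (snd (snd (snd (m_table ! n))))"

lemma length_tables: "length e_table = 28" "length e_gstate = 28" "length m_table = 43"
  by (simp_all add: e_table_def e_gstate_def m_table_def)

text \<open>The refinement simulates the automaton for \<open>G\<close>: each legal step lifts to it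
  and commutes with the projections to \<open>E\<close> and to \<open>G\<close>. Being closed, the
  statement can be decided by evaluation.\<close>

definition tables_match :: bool where
  "tables_match \<longleftrightarrow>
     list_all (\<lambda>(s0, s1, x, _). x < 28 \<and>
       list_all (\<lambda>(d, s). case g_step (e_gstate ! x) d of None \<Rightarrow> True
         | Some g \<Rightarrow> (case s of None \<Rightarrow> False
             | Some n \<Rightarrow> n < 43 \<and> e_step x d = Some (m_e n) \<and> e_gstate ! m_e n = g))
         [(False, s0), (True, s1)]) m_table"

lemma tables_match: "tables_match"
  by code_simp

lemma m_e_less: "n < 43 \<Longrightarrow> m_e n < 28"
  using tables_match
  by (cases "m_table ! n")
    (auto simp: tables_match_def list_all_length length_tables m_e_def dest!: spec[of _ n])

lemma m_step_simulates:
  assumes "n < 43" "g_step (e_gstate ! m_e n) d = Some g"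
  obtains n' where "m_step n d = Some n'" "n' < 43" "e_step (m_e n) d = Some (m_e n')"
    "e_gstate ! m_e n' = g"
proof -
  obtain s0 s1 x y where t: "m_table ! n = (s0, s1, x, y)" by (metis prod.exhaust)
  have x: "m_e n = x" by (simp add: m_e_def t)
  have "list_all (\<lambda>(d, s). case g_step (e_gstate ! x) d of None \<Rightarrow> True
         | Some g \<Rightarrow> (case s of None \<Rightarrow> False
             | Some n \<Rightarrow> n < 43 \<and> e_step x d = Some (m_e n) \<and> e_gstate ! m_e n = g))
         [(False, s0), (True, s1)]"
    using tables_match assms(1) t unfolding tables_match_def list_all_length length_tables
    by (metis (no_types, lifting) case_prod_conv)
  then show thesis
    using assms(2) that t x by (cases d) (auto simp: m_step_def split: option.splits)
qed

text \<open>In particular, \<open>E\<close> is defined on every legal word.\<close>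

lemma run_m:
  assumes "run g_step W0 w = Some g"
  obtains n where "run m_step 0 w = Some n" "n < 43" "run e_step 0 w = Some (m_e n)"
    "e_gstate ! m_e n = g"
proof -
  have "\<exists>n. run m_step 0 w = Some n \<and> n < 43 \<and> run e_step 0 w = Some (m_e n) \<and> e_gstate ! m_e n = g"
    using assms
  proof (induction w arbitrary: g rule: rev_induct)
    case Nil
    then show ?case by (simp add: m_e_def m_table_def e_gstate_def)
  next
    case (snoc d w)
    then obtain g0 where g0: "run g_step W0 w = Some g0" and st: "g_step g0 d = Some g"
      by (auto simp: run_snoc split: bind_splits)
    from snoc.IH[OF g0] obtain n where n: "run m_step 0 w = Some n" "n < 43"
      "run e_step 0 w = Some (m_e n)" "e_gstate ! m_e n = g0" by blast
    from m_step_simulates[of n d g] n st obtain n' where "m_step n d = Some n'" "n' < 43"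
      "e_step (m_e n) d = Some (m_e n')" "e_gstate ! m_e n' = g" by auto
    with n show ?case by (simp add: run_snoc)
  qed
  then show thesis using that by blast
qed

lemma val_eq:
  assumes "run g_step W0 w = Some g"
  shows "int (val w) = wsum (\<lambda>i. pad (i + 2)) w - last_one g"
  using last_digits[OF assms] by (simp add: val_pad)

section \<open>Exhaustive search in bucketed state spaces\<close>

text \<open>Bucket \<open>n\<close> of \<open>acc\<close> holds the second components met with first
  component \<open>n\<close>, so a membership test scans one bucket only.\<close>

fun insert_new :: "'v list list \<Rightarrow> (nat \<times> 'v) list \<Rightarrow> (nat \<times> 'v) list \<Rightarrow> 'v list list \<times> (nat \<times> 'v) list"
  where
  "insert_new acc [] new = (acc, new)"
| "insert_new acc (s # ss) new = (case s of (n, v) \<Rightarrow>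
     if List.member (acc ! n) v then insert_new acc ss new
     else insert_new (acc[n := v # acc ! n]) ss (s # new))"

fun search :: "(nat \<times> 'v \<Rightarrow> (nat \<times> 'v) list) \<Rightarrow> nat \<Rightarrow> 'v list list \<Rightarrow> (nat \<times> 'v) list \<Rightarrow>
    'v list list \<times> (nat \<times> 'v) list" where
  "search succs 0 acc front = (acc, front)"
| "search succs (Suc k) acc front =
     (case insert_new acc (concat (map succs front)) [] of (acc', new) \<Rightarrow> search succs k acc' new)"

definition stored :: "'v list list \<Rightarrow> (nat \<times> 'v) set" where
  "stored acc = {(n, v). n < length acc \<and> v \<in> set (acc ! n)}"

lemma insert_new_stored:
  assumes "insert_new acc ss new = (acc', new')" "\<And>s. s \<in> set ss \<Longrightarrow> fst s < length acc"
  shows "length acc' = length acc \<and> stored acc' = stored acc \<union> set ss \<and>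
    set new \<subseteq> set new' \<and> set new' \<subseteq> set new \<union> set ss \<and> set ss \<subseteq> stored acc \<union> set new'"
  using assms
proof (induction acc ss new rule: insert_new.induct)
  case (2 acc s ss new)
  obtain n v where s: "s = (n, v)" by force
  have n: "n < length acc" using 2(4)[of s] s by simp
  show ?case
  proof (cases "List.member (acc ! n) v")
    case True
    then have "(n, v) \<in> stored acc" using n by (simp add: stored_def List.member_iff)
    then show ?thesis using 2 s True by fastforce
  next
    case False
    have "stored (acc[n := v # acc ! n]) = insert s (stored acc)"
      using n s by (auto simp: stored_def nth_list_update split: if_splits)
    then show ?thesis using 2(2)[OF s[symmetric] False] 2(3,4) s False by fastforce
  qed
qed simp

text \<open>Invariant: a stored state is on the frontier or has all its successors stored. An empty
  final frontier thus certifies closure, and \<open>k\<close> is mere fuel.\<close>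

lemma search_closed:
  assumes "search succs k acc front = (acc', [])"
    and "\<And>s s'. fst s < length acc \<Longrightarrow> s' \<in> set (succs s) \<Longrightarrow> fst s' < length acc"
    and "set front \<subseteq> stored acc"
    and "\<And>s. s \<in> stored acc \<Longrightarrow> s \<in> set front \<or> set (succs s) \<subseteq> stored acc"
  shows "length acc' = length acc \<and> stored acc \<subseteq> stored acc' \<and>
    (\<forall>s\<in>stored acc'. set (succs s) \<subseteq> stored acc')"
  using assms
proof (induction k arbitrary: acc front)
  case (Suc k)
  obtain acc1 new where 1: "insert_new acc (concat (map succs front)) [] = (acc1, new)" by force
  have lt: "fst s' < length acc" if s': "s' \<in> set (concat (map succs front))" for s'
  proof -
    obtain s where s: "s \<in> set front" "s' \<in> set (succs s)"
      using s' by auto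
    then have "fst s < length acc" using Suc.prems(3) by (auto simp: stored_def)
    then show ?thesis using s Suc.prems(2) by blast
  qed
  note ins = insert_new_stored[OF 1 lt]
  have "length acc' = length acc1 \<and> stored acc1 \<subseteq> stored acc' \<and>
    (\<forall>s\<in>stored acc'. set (succs s) \<subseteq> stored acc')"
  proof (rule Suc.IH)
    show "search succs k acc1 new = (acc', [])" using Suc.prems(1) 1 by simp
    show "fst s' < length acc1" if "fst s < length acc1" "s' \<in> set (succs s)" for s s'
      using that ins Suc.prems(2) by auto
    show "set new \<subseteq> stored acc1" using ins by auto
    show "s \<in> set new \<or> set (succs s) \<subseteq> stored acc1" if "s \<in> stored acc1" for s
      using that ins Suc.prems(4)[of s] by fastforce
  qed
  then show ?case using ins by auto
qed auto

section \<open>Pairs of representations\<close>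

type_synonym vec = "int \<times> int \<times> int"

text \<open>The vector \<open>(p, q, r)\<close> stands for the element of \<open>\<int>[\<rho>]\<close>, with \<open>\<rho>\<^sup>3 = \<rho> + 1\<close>, that takes the
  values \<open>p\<close>, \<open>q\<close>, \<open>r\<close> after shifts by two, one and zero places. Multiplication by \<open>\<rho>\<close> maps it to
  \<open>(q, r, p + q)\<close>, and \<open>(1, 1, 2)\<close> is the unit. For a pair of words \<open>X\<close> and \<open>N\<close> read in parallel
  with digits \<open>e\<close> and \<open>d\<close>, the carry is \<open>X - \<rho>\<^sup>-\<^sup>s N\<close>, where \<open>c\<close> is the vector of \<open>\<rho>\<^sup>-\<^sup>s\<close>.\<close>

fun next_carry :: "vec \<Rightarrow> bool \<Rightarrow> bool \<Rightarrow> vec \<Rightarrow> vec" where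
  "next_carry (c2, c1, c0) e d (p, q, r) =
     (q + of_bool e - of_bool d * c2, r + of_bool e - of_bool d * c1,
      p + q + 2 * of_bool e - of_bool d * c0)"

text \<open>In state \<open>W\<^sub>j\<close> the remaining \<open>k\<close> digits contribute at most about \<open>\<rho>\<^sup>k\<^sup>-\<^sup>j\<close>. The potential is
  \<open>\<rho>\<^sup>-\<^sup>j\<close>, so a carry that is \<open>hopeless\<close> cannot be compensated any more; the thresholds \<open>tp\<close> and \<open>tm\<close>
  absorb the bounded corrections to \<open>val X\<close> at the end. Comparing three consecutive places makes this condition stable, since multiplication by
  \<open>\<rho>\<close> has nonnegative coefficients.\<close>

fun potential :: "gstate \<Rightarrow> vec" where
  "potential W0 = (1, 1, 2)"
| "potential W1 = (1, 1, 1)"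
| "potential W2 = (0, 1, 1)"
| "potential W3 = (1, 0, 1)"
| "potential W4 = (0, 1, 0)"
| "potential Term = (0, 0, 0)"

fun exceeds :: "int \<Rightarrow> vec \<Rightarrow> vec \<Rightarrow> bool" where
  "exceeds t (p, q, r) (p', q', r') \<longleftrightarrow> t \<le> r - r' \<and> t \<le> (p - p') + (q - q') \<and> t \<le> (q - q') + (r - r')"

fun negate :: "vec \<Rightarrow> vec" where
  "negate (p, q, r) = (- p, - q, - r)"

fun hopeless :: "int \<Rightarrow> int \<Rightarrow> vec \<Rightarrow> vec \<Rightarrow> vec \<Rightarrow> bool" where
  "hopeless tp tm w u v \<longleftrightarrow> exceeds tp v u \<or> exceeds tm (negate w) v"

type_synonym entry = "nat option \<times> nat option \<times> int \<times> int \<times> vec"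

text \<open>An entry holds the two successors, two outputs and the potential of a state. The outputs are
  arranged so that \<open>outputs_match\<close> says: if \<open>val X\<close> is the shift of \<open>N\<close> corrected by \<open>h\<close>, then the
  formula for \<open>a (val X)\<close> gives \<open>val N\<close> minus the next shift of \<open>N\<close> corrected by \<open>g\<close>.\<close>

definition x_entries :: "entry list" where
  "x_entries = map (\<lambda>x. (e_step x False, e_step x True, e_corr x, last_one (e_gstate ! x),
     potential (e_gstate ! x))) [0..<28]"

definition n_entries :: "(vec \<Rightarrow> vec) \<Rightarrow> (nat \<Rightarrow> int) \<Rightarrow> (nat \<Rightarrow> int) \<Rightarrow> entry list" where
  "n_entries sh h g = map (\<lambda>n. (m_step n False, m_step n True, h n,
     - last_one (e_gstate ! m_e n) - g n, sh (potential (e_gstate ! m_e n)))) [0..<43]"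

fun entry_succ :: "entry \<Rightarrow> bool \<Rightarrow> nat option" where
  "entry_succ (s0, s1, _) d = (if d then s1 else s0)"

fun entry_pot :: "entry \<Rightarrow> vec" where
  "entry_pot (_, _, _, _, u) = u"

definition successors ::
  "vec \<Rightarrow> int \<Rightarrow> int \<Rightarrow> entry list \<Rightarrow> entry list \<Rightarrow> nat \<times> nat \<times> vec \<Rightarrow> (nat \<times> nat \<times> vec) list" where
  "successors c tp tm xs ns = (\<lambda>(n, x, v).
     concat (map (\<lambda>d. case entry_succ (ns ! n) d of None \<Rightarrow> [] | Some n' \<Rightarrow>
       concat (map (\<lambda>e. case entry_succ (xs ! x) e of None \<Rightarrow> [] | Some x' \<Rightarrow>
         (let v' = next_carry c e d v in
          if hopeless tp tm (entry_pot (xs ! x')) (entry_pot (ns ! n')) v' then []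
          else [(n', x', v')])) [False, True])) [False, True]))"

definition outputs_match :: "entry \<Rightarrow> entry \<Rightarrow> vec \<Rightarrow> bool" where
  "outputs_match x n v = (case (x, n, v) of ((_, _, a, l, _), (_, _, h, g, _), (p, q, r)) \<Rightarrow>
     r - l = h \<longrightarrow> p + a = g)"

text \<open>The bounds on \<open>h\<close> make pruning harmless: the premise of
  \<open>outputs_match\<close> forces \<open>r\<close> to be \<open>h\<close> or
  \<open>h + 1\<close>, strictly between \<open>- tm\<close> and \<open>tp\<close>, so such a pair
  is not hopeless.\<close>

definition search_ok :: "int \<Rightarrow> int \<Rightarrow> entry list \<Rightarrow> entry list \<Rightarrow>
    (nat \<times> vec) list list \<times> (nat \<times> nat \<times> vec) list \<Rightarrow> bool" where
  "search_ok tp tm xs ns = (\<lambda>(acc, front). front = [] \<and>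
     list_all (\<lambda>(_, _, h, _). - tm < h \<and> h + 1 < tp) ns \<and>
     list_all2 (\<lambda>n. list_all (\<lambda>(x, v). outputs_match (xs ! x) n v)) ns acc)"

definition pair_search :: "vec \<Rightarrow> int \<Rightarrow> int \<Rightarrow> nat \<Rightarrow> entry list \<Rightarrow> entry list \<Rightarrow> bool" where
  "pair_search c tp tm k xs ns = search_ok tp tm xs ns (search (successors c tp tm xs ns) k
     ([(0, 0, 0, 0)] # replicate 42 []) [(0, 0, 0, 0, 0)])"

fun divide_rho :: "vec \<Rightarrow> vec" where
  "divide_rho (p, q, r) = (r - p, p, q)"

section \<open>Soundness of the search over pairs of words\<close>

definition m_range :: bool where
  "m_range \<longleftrightarrow> list_all (\<lambda>(s0, s1, _).
     list_all (\<lambda>s. case s of None \<Rightarrow> True | Some n \<Rightarrow> n < 43) [s0, s1]) m_table"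

lemma m_step_range:
  assumes "n < 43" "m_step n d = Some n'"
  shows "n' < 43"
proof -
  have m_range by code_simp
  then show ?thesis
    using assms nth_mem[of n m_table]
    by (cases "m_table ! n")
      (fastforce simp: m_range_def list_all_iff length_tables m_step_def split: if_splits)
qed

lemma x_entries_nth:
  "x < 28 \<Longrightarrow> x_entries ! x = (e_step x False, e_step x True, e_corr x,
     last_one (e_gstate ! x), potential (e_gstate ! x))"
  by (simp add: x_entries_def)

lemma n_entries_nth:
  "n < 43 \<Longrightarrow> n_entries sh h g ! n = (m_step n False, m_step n True, h n,
     - last_one (e_gstate ! m_e n) - g n, sh (potential (e_gstate ! m_e n)))"
  by (simp add: n_entries_def)

lemma length_entries: "length x_entries = 28" "length (n_entries sh h g) = 43"
  by (simp_all add: x_entries_def n_entries_def)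

lemma in_successors:
  "(n', x', v') \<in> set (successors c tp tm xs ns (n, x, v)) \<longleftrightarrow>
     (\<exists>d e. entry_succ (ns ! n) d = Some n' \<and> entry_succ (xs ! x) e = Some x' \<and>
        v' = next_carry c e d v \<and> \<not> hopeless tp tm (entry_pot (xs ! x')) (entry_pot (ns ! n')) v')"
  by (auto simp: successors_def Let_def ex_bool_eq split: option.splits)

text \<open>Reading both words in parallel ends in a stored or a hopeless state: a successor is
  stored unless it is hopeless, and hopeless states stay so by \<open>plus\<close> and
  \<open>minus\<close>. The hypothesis on \<open>r\<close> rules out a hopeless end, which leaves
  the checked outputs.\<close>

lemma pair_search_sound:
  assumes ok: "pair_search c tp tm k x_entries (n_entries sh h g)"
    and plus: "\<And>gn gn' e d v. g_step gn d = Some gn' \<Longrightarrow> exceeds tp v (sh (potential gn)) \<Longrightarrow>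
      exceeds tp (next_carry c e d v) (sh (potential gn'))"
    and minus: "\<And>gx gx' e d v. g_step gx e = Some gx' \<Longrightarrow> exceeds tm (negate (potential gx)) v \<Longrightarrow>
      exceeds tm (negate (potential gx')) (next_carry c e d v)"
    and nonneg: "\<And>gn. 0 \<le> snd (snd (sh (potential gn)))"
    and runs: "run g_step W0 (map fst ps) \<noteq> None" "run g_step W0 (map snd ps) \<noteq> None"
      "run e_step 0 (map fst ps) = Some x" "run m_step 0 (map snd ps) = Some n"
    and carry: "foldl (\<lambda>v (e, d). next_carry c e d v) (0, 0, 0) ps = (p, q, r)"
    and hyp: "r - last_one (e_gstate ! x) = h n"
  shows "p + e_corr x = - last_one (e_gstate ! m_e n) - g n"
proof -
  let ?ns = "n_entries sh h g"
  let ?succs = "successors c tp tm x_entries ?ns"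
  let ?acc0 = "[(0, 0, 0, 0)] # replicate 42 [] :: (nat \<times> vec) list list"
  obtain acc front where "search ?succs k ?acc0 [(0, 0, 0, 0, 0)] = (acc, front)" by force
  then have se: "search ?succs k ?acc0 [(0, 0, 0, 0, 0)] = (acc, [])"
    and bounds: "list_all (\<lambda>(_, _, h, _). - tm < h \<and> h + 1 < tp) ?ns"
    and out: "list_all2 (\<lambda>n. list_all (\<lambda>(x, v). outputs_match (x_entries ! x) n v)) ?ns acc"
    using ok by (auto simp: pair_search_def search_ok_def)
  have stored0: "stored ?acc0 = {(0, 0, 0, 0, 0)}"
    by (auto simp: stored_def nth_Cons split: nat.splits)
  have cl: "length acc = length ?acc0 \<and> stored ?acc0 \<subseteq> stored acc \<and>
    (\<forall>s\<in>stored acc. set (?succs s) \<subseteq> stored acc)"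
  proof (rule search_closed[OF se])
    fix s s' :: "nat \<times> nat \<times> vec"
    assume "fst s < length ?acc0" "s' \<in> set (?succs s)"
    moreover obtain m y u m' y' u' where "s = (m, y, u)" "s' = (m', y', u')"
      by (metis prod.exhaust)
    ultimately have "m < 43" "(m', y', u') \<in> set (?succs (m, y, u))" "s' = (m', y', u')" by auto
    moreover from this obtain d where "m_step m d = Some m'"
      by (auto simp: in_successors n_entries_nth split: if_splits)
    ultimately show "fst s' < length ?acc0" using m_step_range by simp
  qed (simp_all add: stored0)
  have "(n, x, p, q, r) \<in> stored acc \<or>
    hopeless tp tm (potential (e_gstate ! x)) (sh (potential (e_gstate ! m_e n))) (p, q, r)"
    using runs carry
  proof (induction ps arbitrary: x n p q r rule: rev_induct)
    case Nil
    then show ?case using cl stored0 by auto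
  next
    case (snoc ed ps)
    obtain e d where ed: "ed = (e, d)" by force
    obtain gx gx' where gx: "run g_step W0 (map fst ps) = Some gx" "g_step gx e = Some gx'"
      using snoc.prems(1) by (auto simp: run_snoc ed split: bind_splits)
    obtain gn gn' where gn: "run g_step W0 (map snd ps) = Some gn" "g_step gn d = Some gn'"
      using snoc.prems(2) by (auto simp: run_snoc ed split: bind_splits)
    obtain y where y: "y < 43" "run e_step 0 (map fst ps) = Some (m_e y)" "e_gstate ! m_e y = gx"
      by (rule run_m[OF gx(1)])
    obtain m where m: "run m_step 0 (map snd ps) = Some m" "m < 43" "e_gstate ! m_e m = gn"
      by (rule run_m[OF gn(1)])
    have x: "e_step (m_e y) e = Some x" and n: "m_step m d = Some n"
      using snoc.prems(3,4) y(2) m(1) by (simp_all add: run_snoc ed)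
    from m_step_simulates[OF y(1), of e gx'] y(3) gx(2) x
    have x': "x < 28" "e_gstate ! x = gx'" using m_e_less by auto
    from m_step_simulates[OF m(2), of d gn'] m(3) gn(2) n
    have n': "n < 43" "e_gstate ! m_e n = gn'" by auto
    obtain p0 q0 r0 where v: "foldl (\<lambda>v (e, d). next_carry c e d v) (0, 0, 0) ps = (p0, q0, r0)"
      by (metis prod.exhaust)
    have v': "next_carry c e d (p0, q0, r0) = (p, q, r)" using snoc.prems(5) v by (simp add: ed)
    from snoc.IH[OF _ _ y(2) m(1) v] gx(1) gn(1) m(3) y(3)
    consider "(m, m_e y, p0, q0, r0) \<in> stored acc"
      | "hopeless tp tm (potential gx) (sh (potential gn)) (p0, q0, r0)" by auto
    then show ?case
    proof cases
      case 1
      then have *: "set (?succs (m, m_e y, p0, q0, r0)) \<subseteq> stored acc" using cl by blast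
      have "entry_succ (?ns ! m) d = Some n" "entry_succ (x_entries ! m_e y) e = Some x"
        using n x m(2) m_e_less[OF y(1)] by (auto simp: n_entries_nth x_entries_nth)
      then have "(n, x, p, q, r) \<in> set (?succs (m, m_e y, p0, q0, r0)) \<or>
        hopeless tp tm (entry_pot (x_entries ! x)) (entry_pot (?ns ! n)) (p, q, r)"
        unfolding in_successors v'[symmetric] by blast
      then show ?thesis using * x' n' by (auto simp: n_entries_nth x_entries_nth)
    next
      case 2
      then have "hopeless tp tm (potential gx') (sh (potential gn')) (next_carry c e d (p0, q0, r0))"
        unfolding hopeless.simps using plus[OF gn(2)] minus[OF gx(2)] by blast
      then show ?thesis using v' x' n' by simp
    qed
  qed
  moreover have "n < 43" "x < 28"
    using run_m[of "map snd ps"] run_m[of "map fst ps"] runs m_e_less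
    by (metis not_Some_eq option.inject)+
  moreover have h: "- tm < h n" "h n + 1 < tp"
    using bounds \<open>n < 43\<close> by (auto simp: list_all_length length_entries n_entries_nth)
  moreover have "\<not> hopeless tp tm (potential (e_gstate ! x)) (sh (potential (e_gstate ! m_e n))) (p, q, r)"
  proof -
    have "\<not> exceeds tp (p, q, r) (sh (potential (e_gstate ! m_e n)))"
      using h hyp nonneg[of "e_gstate ! m_e n"]
      by (cases "sh (potential (e_gstate ! m_e n))"; cases "e_gstate ! x") auto
    moreover have "\<not> exceeds tm (negate (potential (e_gstate ! x))) (p, q, r)"
      using h hyp by (cases "e_gstate ! x") auto
    ultimately show ?thesis by (simp add: hopeless.simps)
  qed
  ultimately have "(x, p, q, r) \<in> set (acc ! n)" by (auto simp: stored_def)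
  then have "outputs_match (x_entries ! x) (?ns ! n) (p, q, r)"
    using out \<open>n < 43\<close> by (auto simp: list_all2_conv_all_nth length_entries list_all_iff)
  then show ?thesis using hyp \<open>n < 43\<close> \<open>x < 28\<close>
    by (simp add: outputs_match_def n_entries_nth x_entries_nth)
qed

text \<open>The number in the name is the shift s. In all three searches the thresholds are the
  least that the values of \<open>h\<close> allow.\<close>

lemma pair_search_0:
  "pair_search (1, 1, 2) 1 3 30 x_entries
     (n_entries id (\<lambda>n. - last_one (e_gstate ! m_e n) - 1) m_corr3)"
  by code_simp

lemma pair_search_1:
  "pair_search (1, 1, 1) 2 2 30 x_entries (n_entries divide_rho m_corr1 (\<lambda>n. e_corr (m_e n)))"
  by code_simp

lemma pair_search_3:
  "pair_search (1, 0, 1) 3 2 33 x_entries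
     (n_entries (divide_rho \<circ> divide_rho \<circ> divide_rho) m_corr3 m_corr1)"
  by code_simp

section \<open>Values of legal words\<close>

text \<open>Outside \<open>Term\<close>, the values of legal words of length \<open>l\<close> are
  exactly the numbers below this bound. At \<open>l = j\<close> in state \<open>Wj\<close> it is 2,
  not \<open>U 0\<close>, because of the exceptional final one.\<close>

fun val_bound :: "gstate \<Rightarrow> nat \<Rightarrow> nat" where
  "val_bound W0 l = U l"
| "val_bound W1 l = (if l < 1 then 1 else if l = 1 then 2 else U (l - 1))"
| "val_bound W2 l = (if l < 2 then 1 else if l = 2 then 2 else U (l - 2))"
| "val_bound W3 l = (if l < 3 then 1 else if l = 3 then 2 else U (l - 3))"
| "val_bound W4 l = (if l < 4 then 1 else if l = 4 then 2 else U (l - 4))"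
| "val_bound Term l = 1"

lemma val_bound_Suc:
  "val_bound W4 (Suc l) = val_bound W3 l" "val_bound W3 (Suc l) = val_bound W2 l" "val_bound W2 (Suc l) = val_bound W1 l"
  by (simp_all add: numeral_eq_Suc)

lemma U_step: "U (p + 6) = U (p + 5) + U (p + 1)"
  by (induction p rule: U.induct) (auto simp: numeral_eq_Suc)

text \<open>Splits the numbers below \<open>U (Suc l)\<close> by first digit: after a one, the rest
  must be legal from \<open>W4\<close>. For large \<open>l\<close> this is rho^5 = rho^4 +
  1.\<close>

lemma U_Suc_val_bound: "U (Suc l) = U l + val_bound W4 l"
proof (cases "l < 5")
  case True
  then have "l = 0 \<or> l = 1 \<or> l = 2 \<or> l = 3 \<or> l = 4" by auto
  then show ?thesis by (auto simp: numeral_eq_Suc)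
next
  case False
  then obtain p where "l = p + 5" by (metis add.commute le_Suc_ex not_less)
  then show ?thesis using U_step[of p] by (simp add: numeral_eq_Suc)
qed

lemma U_Suc_greater: "U l < U (Suc l)"
  using U_pos[of "l - 4"] by (simp add: U_Suc_val_bound)

lemma U_strict_mono: "strict_mono U"
  by (simp add: strict_mono_Suc_iff U_Suc_greater)

lemma val_Nil [simp]: "val [] = 0"
  by (simp add: val_def)

lemma val_Cons: "val (b # w) = of_bool b * U (length w) + val w"
  by (simp add: val_wsum wsum_Cons)

lemma val_less_bound: "run g_step q w \<noteq> None \<Longrightarrow> val w < val_bound q (length w)"
proof (induction w arbitrary: q)
  case Nil
  show ?case using U_pos[of 0] by (cases q) auto
next
  case (Cons b w)
  then obtain q' where st: "g_step q b = Some q'" and r: "run g_step q' w \<noteq> None"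
    by (auto split: bind_splits)
  have less: "val w < val_bound q' (length w)" using Cons.IH[OF r] .
  from st show ?case
  proof (cases rule: g_step_cases)
    case 2
    then show ?thesis using less U_Suc_val_bound[of "length w"] by (simp add: val_Cons del: val_bound.simps(5))
  next
    case 4
    then have "w = []" using r by (cases w) auto
    then show ?thesis using 4 by (simp add: val_Cons)
  qed (use less U_Suc_greater[of "length w"] in \<open>auto simp: val_Cons Suc_diff_Suc split: if_splits\<close>)
qed

lemma val_bound_le_U: "val_bound q l \<le> U l"
proof -
  have "1 \<le> U l" "U (l - k) \<le> U l" for k
    using U_pos[of l] by (simp_all add: strict_mono_less_eq[OF U_strict_mono])
  moreover have "2 \<le> U l" if "1 \<le> l"
    using that strict_mono_less_eq[OF U_strict_mono, of 1 l] by simp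
  ultimately show ?thesis by (cases q) auto
qed

lemma val_less_U: "run g_step q w \<noteq> None \<Longrightarrow> val w < U (length w)"
  using val_less_bound[of q w] val_bound_le_U[of q "length w"] by linarith

text \<open>The digits are chosen greedily: in \<open>W0\<close>, a one is taken as soon as the
  current weight fits.\<close>

lemma word_exists:
  assumes "m < val_bound q l" "q \<noteq> Term"
  shows "\<exists>w. length w = l \<and> run g_step q w \<noteq> None \<and> val w = m"
  using assms
proof (induction l arbitrary: q m)
  case 0
  then have "m = 0" by (cases q) auto
  then show ?case by simp
next
  case (Suc l)
  have ext: ?case if st: "g_step q b = Some q'" "of_bool b * U l \<le> m"
    and m: "m - of_bool b * U l < val_bound q' l" "q' \<noteq> Term" for b q'
  proof -
    obtain w where "length w = l" "run g_step q' w \<noteq> None" "val w = m - of_bool b * U l"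
      using Suc.IH[OF m] by blast
    then show ?thesis using st by (intro exI[of _ "b # w"]) (auto simp: val_Cons)
  qed
  show ?case
  proof (cases q)
    case W0
    then show ?thesis
      using Suc.prems ext[of False W0] ext[of True W4] U_Suc_val_bound[of l] by force
  next
    case W1
    show ?thesis
    \<comment> \<open>The exceptional final one leads to \<open>Term\<close> and is therefore not
      covered by \<open>ext\<close>.\<close>
    proof (cases "l = 0 \<and> m = 1")
      case True
      then show ?thesis using W1 by (intro exI[of _ "[True]"]) (auto simp: val_Cons)
    next
      case False
      then show ?thesis using Suc.prems W1 ext[of False W0] by (cases l) auto
    qed
  next
    case W2
    then show ?thesis using Suc.prems ext[of False W1] by (simp add: val_bound_Suc del: val_bound.simps)
  next
    case W3
    then show ?thesis using Suc.prems ext[of False W2] by (simp add: val_bound_Suc del: val_bound.simps)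
  next
    case W4
    then show ?thesis using Suc.prems ext[of False W3] by (simp add: val_bound_Suc del: val_bound.simps)
  qed (use Suc.prems in auto)
qed

lemma U_neq_0 [simp]: "U p \<noteq> 0"
  using U_pos[of p] by simp

lemma val_eq_0: "val w = 0 \<Longrightarrow> w = replicate (length w) False"
  by (induction w) (auto simp: val_Cons)

lemma val_eq_1: "val w = 1 \<Longrightarrow> \<exists>k. w = replicate k False @ [True]"
proof (induction w)
  case (Cons b w)
  show ?case
  proof (cases b)
    case True
    then have "U (length w) \<le> U 0" using Cons.prems by (simp add: val_Cons)
    then have "w = []" unfolding strict_mono_less_eq[OF U_strict_mono] by simp
    then show ?thesis using True by (intro exI[of _ 0]) simp
  next
    case False
    then obtain k where "w = replicate k False @ [True]" using Cons by (auto simp: val_Cons)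
    then show ?thesis using False by (intro exI[of _ "Suc k"]) simp
  qed
qed simp

section \<open>The formula for the sequence\<close>

text \<open>\<open>place 2\<close> is the value up to the final digit, \<open>place 1\<close> and
  \<open>place 0\<close> are its shifts by one and two places. By the recursion,
  \<open>place 2 w - place 0 w\<close> is the shift by three.\<close>

definition place :: "nat \<Rightarrow> bool list \<Rightarrow> int" where
  "place k w = wsum (\<lambda>i. pad (i + k)) w"

lemma place_Nil [simp]: "place k [] = 0"
  by (simp add: place_def)

lemma place_snoc: "place k (w @ [d]) = of_bool d * pad k + place (Suc k) w"
  by (simp add: place_def wsum_snoc)

lemma place_rec: "place (Suc (Suc (Suc k))) w = place (Suc k) w + place k w"
  by (simp add: place_def wsum_add)

lemma val_place:
  "run g_step W0 w = Some g \<Longrightarrow> int (val w) = place 2 w - last_one g"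
  by (simp add: val_eq place_def)

lemma carry0:
  "foldl (\<lambda>v (e, d). next_carry (1, 1, 2) e d v) (0, 0, 0) ps =
    (let X = map fst ps; N = map snd ps in
     (place 0 X - place 0 N, place 1 X - place 1 N, place 2 X - place 2 N))"
proof (induction ps rule: rev_induct)
  case (snoc ed ps)
  then show ?case by (cases ed) (simp add: Let_def place_snoc numeral_2_eq_2 place_rec)
qed simp

lemma carry1:
  "foldl (\<lambda>v (e, d). next_carry (1, 1, 1) e d v) (0, 0, 0) ps =
    (let X = map fst ps; N = map snd ps in
     (place 0 X - (place 2 N - place 0 N), place 1 X - place 0 N, place 2 X - place 1 N))"
proof (induction ps rule: rev_induct)
  case (snoc ed ps)
  then show ?case by (cases ed) (simp add: Let_def place_snoc numeral_2_eq_2 place_rec)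
qed simp

text \<open>Places -3, -2 and -1 of \<open>N\<close> are rewritten through places 0, 1 and 2 by the
  recursion.\<close>

lemma carry3:
  "foldl (\<lambda>v (e, d). next_carry (1, 0, 1) e d v) (0, 0, 0) ps =
    (let X = map fst ps; N = map snd ps in
     (place 0 X - (place 2 N - place 1 N), place 1 X - (place 1 N - place 2 N + place 0 N),
      place 2 X - (place 2 N - place 0 N)))"
proof (induction ps rule: rev_induct)
  case (snoc ed ps)
  then show ?case by (cases ed) (simp add: Let_def place_snoc numeral_2_eq_2 place_rec)
qed simp

text \<open>A step with digit e takes a potential u to at most rho u - e, with equality except from
  \<open>W0\<close> to itself; for \<open>W4\<close> this is rho^-4 = rho - 1. So the new gap is rho
  times the old one plus nonnegative terms.\<close>

lemma exceeds_minus_step: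
  assumes "c \<in> {(1, 1, 2), (1, 1, 1), (1, 0, 1)}" "0 \<le> t"
    "g_step gx e = Some gx'" "exceeds t (negate (potential gx)) v"
  shows "exceeds t (negate (potential gx')) (next_carry c e d v)"
  using assms(3)
  by (cases rule: g_step_cases; cases v; cases d) (use assms(1,2,4) in auto)

lemma exceeds_plus_step:
  assumes "(c, sh) \<in> {((1, 1, 2), id), ((1, 1, 1), divide_rho),
      ((1, 0, 1), divide_rho \<circ> divide_rho \<circ> divide_rho)}" "0 \<le> t"
    "g_step gn d = Some gn'" "exceeds t v (sh (potential gn))"
  shows "exceeds t (next_carry c e d v) (sh (potential gn'))"
  using assms(3)
  by (cases rule: g_step_cases; cases v; cases e) (use assms(1,2,4) in auto)

context
  fixes X N :: "bool list" and gx gn :: gstate and x n :: nat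
  assumes len: "length X = length N"
    and X: "run g_step W0 X = Some gx" "run e_step 0 X = Some x"
    and N: "run g_step W0 N = Some gn" "run m_step 0 N = Some n"
begin

lemma pair_facts:
  "map fst (zip X N) = X" "map snd (zip X N) = N"
  "e_gstate ! x = gx" "e_gstate ! m_e n = gn"
  using len run_m[OF X(1)] run_m[OF N(1)] X N by auto

lemma pair_search_transfer:
  assumes ok: "pair_search c tp tm k x_entries (n_entries sh h g)"
    and c: "(c, sh) \<in> {((1, 1, 2), id), ((1, 1, 1), divide_rho),
      ((1, 0, 1), divide_rho \<circ> divide_rho \<circ> divide_rho)}"
    and t: "0 \<le> tp" "0 \<le> tm"
    and carry: "foldl (\<lambda>v (e, d). next_carry c e d v) (0, 0, 0) (zip X N) = (p, q, r)"
    and hyp: "r - last_one gx = h n"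
  shows "p + e_corr x = - last_one gn - g n"
proof -
  have "p + e_corr x = - last_one (e_gstate ! m_e n) - g n"
  proof (rule pair_search_sound[OF ok _ _ _ _ _ _ _ carry])
    show "0 \<le> snd (snd (sh (potential gn)))" for gn
      using c by (cases gn) auto
  qed (use exceeds_plus_step[OF c t(1)] exceeds_minus_step[of c, OF _ t(2)] c X N hyp
      in \<open>auto simp: pair_facts\<close>)
  then show ?thesis by (simp add: pair_facts)
qed

text \<open>With the formula for a at \<open>val X\<close>, the left side is n - a(n-1). Its right
  side is the hypothesis of \<open>first_argument\<close>, whose right side is in turn that of
  \<open>second_argument\<close>.\<close>

lemma pred_shift:
  assumes "val N = Suc (val X)"
  shows "int (val N) - (place 0 X + e_corr x) = place 2 N - place 0 N + m_corr3 n"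
proof -
  have "place 0 X - place 0 N + e_corr x = - last_one gn - m_corr3 n"
    by (rule pair_search_transfer[OF pair_search_0 _ _ _ carry0[of "zip X N", unfolded Let_def pair_facts]])
      (use assms val_place[OF N(1)] val_place[OF X(1)] in \<open>auto simp: pair_facts\<close>)
  then show ?thesis using val_place[OF N(1)] by simp
qed

lemma first_argument:
  assumes "int (val X) = place 2 N - place 0 N + m_corr3 n"
  shows "int (val N) - (place 0 X + e_corr x) = place 1 N + m_corr1 n"
proof -
  have "place 0 X - (place 2 N - place 1 N) + e_corr x = - last_one gn - m_corr1 n"
    by (rule pair_search_transfer[OF pair_search_3 _ _ _ carry3[of "zip X N", unfolded Let_def pair_facts]])
      (use assms val_place[OF X(1)] in auto)
  then show ?thesis using val_place[OF N(1)] by simp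
qed

lemma second_argument:
  assumes "int (val X) = place 1 N + m_corr1 n"
  shows "int (val N) - (place 0 X + e_corr x) = place 0 N + e_corr (m_e n)"
proof -
  have "place 0 X - (place 2 N - place 0 N) + e_corr x = - last_one gn - e_corr (m_e n)"
    by (rule pair_search_transfer[OF pair_search_1 _ _ _ carry1[of "zip X N", unfolded Let_def pair_facts]])
      (use assms val_place[OF X(1)] in auto)
  then show ?thesis using val_place[OF N(1)] by simp
qed

end

section \<open>Induction along the recursion\<close>

lemma seq_a_bounds: "seq_a n \<le> n" "0 < n \<Longrightarrow> 0 < seq_a n"
proof -
  have "seq_a n \<le> n \<and> (0 < n \<longrightarrow> 0 < seq_a n)"
  proof (induction n rule: less_induct)
    case (less n)
    show ?case
    proof (cases "2 \<le> n")
      case True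
      define s where "s = n - seq_a (n - 1)"
      define t where "t = n - seq_a s"
      have "0 < s" "s < n" using less[of "n - 1"] True by (auto simp: s_def)
      then have "0 < t" "t < n" using less[of s] by (auto simp: t_def)
      then show ?thesis using less[of t] seq_a_rec[OF True] by (auto simp: s_def t_def)
    next
      case False
      then have "n = 0 \<or> n = 1" by auto
      then show ?thesis by auto
    qed
  qed
  then show "seq_a n \<le> n" "0 < n \<Longrightarrow> 0 < seq_a n" by auto
qed

lemma seq_a_place:
  assumes "run g_step W0 w = Some g" "run e_step 0 w = Some x"
  shows "int (seq_a (val w)) = place 0 w + e_corr x"
  using assms
proof (induction "val w" arbitrary: w g x rule: less_induct)
  case less
  have run_False: "run e_step 0 (replicate k False) = Some 0" for k
    by (induction k) (simp_all add: e_step_def e_table_def)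
  consider "val w = 0" | "val w = 1" | "2 \<le> val w" by linarith
  then show ?case
  proof cases
    case 1
    then obtain k where "w = replicate k False" using val_eq_0 by blast
    moreover from this have "x = 0" using less.prems run_False by simp
    ultimately show ?thesis
      using 1 by (simp add: place_def e_corr_def e_table_def e_gstate_def)
  next
    case 2
    then obtain k where k: "w = replicate k False @ [True]" using val_eq_1 by blast
    moreover from this have "x = 1" using less.prems run_False
      by (simp add: run_snoc e_step_def e_table_def)
    ultimately show ?thesis
      using 2 by (simp add: place_def wsum_snoc e_corr_def e_table_def e_gstate_def)
  next
    case 3
    let ?n = "val w"
    obtain n where n: "run m_step 0 w = Some n" "n < 43" "x = m_e n"
      using run_m[OF less.prems(1)] less.prems(2) by (metis option.inject)
    \<comment> \<open>Smaller numbers get words of the same length as \<open>w\<close>, as the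
      searches read two words in parallel.\<close>
    have word: "\<exists>u gu xu. length u = length w \<and> run g_step W0 u = Some gu \<and>
      run e_step 0 u = Some xu \<and> val u = m \<and> int (seq_a m) = place 0 u + e_corr xu"
      if m: "m < ?n" for m
    proof -
      have "\<exists>u. length u = length w \<and> run g_step W0 u \<noteq> None \<and> val u = m"
        by (rule word_exists) (use m val_less_U[of W0 w] less.prems(1) in simp_all)
      then obtain u where u: "length u = length w" "run g_step W0 u \<noteq> None" "val u = m"
        by blast
      then obtain gu where gu: "run g_step W0 u = Some gu" by auto
      then obtain xu where xu: "run e_step 0 u = Some xu" using run_m by metis
      show ?thesis using u gu xu less.hyps[of u gu xu] m by blast
    qed
    define s where "s = ?n - seq_a (?n - 1)"
    define t where "t = ?n - seq_a s"
    have s: "s < ?n" "0 < s" "int s = int ?n - int (seq_a (?n - 1))"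
      using 3 seq_a_bounds[of "?n - 1"] by (auto simp: s_def)
    have t: "t < ?n" "int t = int ?n - int (seq_a s)"
      using s seq_a_bounds[of s] by (auto simp: t_def)
    obtain u gu xu where u: "length u = length w" "run g_step W0 u = Some gu"
      "run e_step 0 u = Some xu" "val u = ?n - 1" "int (seq_a (?n - 1)) = place 0 u + e_corr xu"
      using word[of "?n - 1"] 3 by auto
    have 1: "int s = place 2 w - place 0 w + m_corr3 n"
      using pred_shift[OF u(1-3) less.prems(1) n(1)] u(4,5) s 3 by simp
    obtain v gv xv where v: "length v = length w" "run g_step W0 v = Some gv"
      "run e_step 0 v = Some xv" "val v = s" "int (seq_a s) = place 0 v + e_corr xv"
      using word[OF s(1)] by auto
    have 2: "int t = place 1 w + m_corr1 n"
      using first_argument[OF v(1-3) less.prems(1) n(1)] v(4,5) t 1 by simp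
    obtain y gy xy where y: "length y = length w" "run g_step W0 y = Some gy"
      "run e_step 0 y = Some xy" "val y = t" "int (seq_a t) = place 0 y + e_corr xy"
      using word[OF t(1)] by auto
    have "int ?n - int (seq_a t) = place 0 w + e_corr x"
      using second_argument[OF y(1-3) less.prems(1) n(1)] y(4,5) 2 n(3) by simp
    moreover have "seq_a ?n = ?n - seq_a t"
      using seq_a_rec[OF 3] by (simp add: s_def t_def)
    ultimately show ?thesis using seq_a_bounds(1)[of t] t(1) by simp
  qed
qed

section \<open>The language of greedy representations\<close>

fun wait :: "gstate \<Rightarrow> nat" where
  "wait W0 = 0" | "wait W1 = 1" | "wait W2 = 2" | "wait W3 = 3" | "wait W4 = 4" | "wait Term = 5"

text \<open>A longer wait forbids more. In particular, dropping a leading one leaves a word legal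
  from \<open>W0\<close>.\<close>

lemma run_wait_mono:
  assumes "run g_step q w \<noteq> None" "wait q' \<le> wait q"
  shows "run g_step q' w \<noteq> None"
  using assms
proof (induction w arbitrary: q q')
  case (Cons b w)
  from Cons.prems obtain r where r: "g_step q b = Some r" "run g_step r w \<noteq> None"
    by (auto split: bind_splits)
  have "\<exists>r'. g_step q' b = Some r' \<and> wait r' \<le> wait r"
    using r(1) Cons.prems(2) by (cases rule: g_step_cases; cases q') auto
  then show ?case using Cons.IH[OF r(2)] by auto
qed simp

fun ones :: "bool list \<Rightarrow> nat list" where
  "ones [] = []"
| "ones (b # w) = (if b then length w # ones w else ones w)"

lemma ones_less: "p \<in> set (ones w) \<Longrightarrow> p < length w"
  by (induction w) (auto split: if_splits)

lemma map_in_ones: "map (\<lambda>p. p \<in> set (ones w)) (rev [0..<length w]) = w"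
proof (induction w)
  case (Cons b w)
  have "map (\<lambda>p. p \<in> set (ones (b # w))) (rev [0..<length w]) =
    map (\<lambda>p. p \<in> set (ones w)) (rev [0..<length w])"
    by (rule map_cong) auto
  then show ?case using Cons ones_less[of "length w" w] by auto
qed simp

text \<open>A leading one is the greedy choice, as \<open>val_less_U\<close> puts the whole value
  below the next weight.\<close>

lemma greedy_positions_val:
  "run g_step W0 w \<noteq> None \<Longrightarrow> greedy_positions (val w) = ones w"
proof (induction w)
  case Nil
  show ?case by (simp add: greedy_positions.simps)
next
  case (Cons b w)
  have w: "run g_step W0 w \<noteq> None"
    using Cons.prems by (cases b) (auto intro: run_wait_mono[of W4, THEN not_None_eq[THEN iffD1]])
  show ?case
  proof (cases b)
    case True
    have "(GREATEST p. U p \<le> val (b # w)) = length w"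
    proof (rule Greatest_equality)
      show "U (length w) \<le> val (b # w)" using True by (simp add: val_Cons)
      fix p assume "U p \<le> val (b # w)"
      then have "U p < U (Suc (length w))" using val_less_U[OF Cons.prems] by simp
      then show "p \<le> length w" by (simp add: strict_mono_less[OF U_strict_mono])
    qed
    moreover have "val (b # w) \<noteq> 0" "val (b # w) - U (length w) = val w"
      using True by (simp_all add: val_Cons)
    ultimately show ?thesis
      using Cons.IH[OF w] True by (subst greedy_positions.simps) simp
  next
    case False
    then show ?thesis using Cons.IH[OF w] by (simp add: val_Cons)
  qed
qed

lemma legal_greedy_word:
  "run g_step W0 w \<noteq> None \<Longrightarrow> \<exists>z. w = replicate z False @ greedy_word (val w)"
proof (induction w)
  case Nil
  show ?case by (simp add: greedy_word_def)
next
  case (Cons b w)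
  show ?case
  proof (cases b)
    case True
    have "val (b # w) \<noteq> 0" using True by (simp add: val_Cons)
    moreover have "greedy_positions (val (b # w)) = length w # ones w"
      using greedy_positions_val[OF Cons.prems] True by simp
    ultimately have "greedy_word (val (b # w)) = b # w"
      using map_in_ones[of "b # w"] True by (simp add: greedy_word_def)
    then show ?thesis by (intro exI[of _ 0]) simp
  next
    case False
    then obtain z where "w = replicate z False @ greedy_word (val w)" using Cons by auto
    then show ?thesis using False by (intro exI[of _ "Suc z"]) (simp add: val_Cons)
  qed
qed

lemma run_replicate_False: "run g_step W0 (replicate z False @ w) = run g_step W0 w"
  by (induction z) auto

lemma legal_word_exists:
  assumes "n < l"
  shows "\<exists>w. length w = l \<and> run g_step W0 w \<noteq> None \<and> val w = n"
proof (rule word_exists)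
  have "l \<le> U l" by (rule strict_mono_imp_increasing[OF U_strict_mono])
  then show "n < val_bound W0 l" using assms by simp
qed simp

text \<open>Forward, \<open>greedy_word n\<close> is not analysed directly: some legal word has
  value \<open>n\<close>, and it must be \<open>greedy_word n\<close> after leading zeros.\<close>

lemma G_iff: "w \<in> G \<longleftrightarrow> run g_step W0 w \<noteq> None"
proof
  assume "w \<in> G"
  then obtain z n where w: "w = replicate z False @ greedy_word n" by (auto simp: G_def)
  obtain u where u: "run g_step W0 u \<noteq> None" "val u = n" using legal_word_exists[of n "Suc n"] by auto
  with legal_greedy_word[OF u(1)] show "run g_step W0 w \<noteq> None"
    by (metis run_replicate_False w)
next
  assume "run g_step W0 w \<noteq> None"
  then show "w \<in> G" using legal_greedy_word unfolding G_def by blast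
qed

section \<open>Reachable pairs\<close>

definition pair_succs :: "nat \<times> gstate \<Rightarrow> (nat \<times> gstate) list" where
  "pair_succs = (\<lambda>(x, g). concat (map (\<lambda>d. case (e_step x d, g_step g d) of
     (Some x', Some g') \<Rightarrow> [(x', g')] | _ \<Rightarrow> []) [False, True]))"

fun pairs_within :: "nat \<Rightarrow> (nat \<times> gstate) list" where
  "pairs_within 0 = [(0, W0)]"
| "pairs_within (Suc k) = (let xs = pairs_within k in remdups (xs @ concat (map pair_succs xs)))"

lemma pairs_within_reaches:
  "y \<in> set (pairs_within k) \<Longrightarrow> \<exists>w. length w \<le> k \<and> reaches w y"
proof (induction k arbitrary: y)
  case 0
  then show ?case by (auto simp: reaches_def)
next
  case (Suc k)
  then consider "y \<in> set (pairs_within k)"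
    | z where "z \<in> set (pairs_within k)" "y \<in> set (pair_succs z)"
    by (auto simp: Let_def)
  then show ?case
  proof cases
    case 1
    then show ?thesis using Suc.IH le_SucI by blast
  next
    case 2
    then obtain d where d: "e_step (fst z) d = Some (fst y)" "g_step (snd z) d = Some (snd y)"
      by (auto simp: pair_succs_def split: option.splits prod.splits)
    obtain w where "length w \<le> k" "reaches w z" using Suc.IH[OF 2(1)] by blast
    then show ?thesis using d by (intro exI[of _ "w @ [d]"]) (auto simp: reaches_def run_snoc)
  qed
qed

lemma pairs_within_13:
  "let ys = pairs_within 13 in list_all (\<lambda>x. List.member ys (x, e_gstate ! x)) [0..<28]"
  by code_simp

lemma reaches_cases:
  assumes "run g_step W0 w = Some g"
  obtains x where "x < 28" "g = e_gstate ! x" "reaches w (x, g)"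
  using run_m[OF assms] m_e_less assms by (metis fst_conv reaches_def snd_conv)

lemma reachable_pairs_eq: "reachable_pairs = (\<lambda>x. (x, e_gstate ! x)) ` {..<28}"
  and short_prefix: "y \<in> reachable_pairs \<Longrightarrow> \<exists>w\<in>G. reaches w y \<and> length w \<le> 13"
proof -
  have sub: "reachable_pairs \<subseteq> (\<lambda>x. (x, e_gstate ! x)) ` {..<28}"
  proof
    fix y assume "y \<in> reachable_pairs"
    then obtain w where w: "reaches w y" by (auto simp: reachable_pairs_def)
    then have "run g_step W0 w = Some (snd y)" by (simp add: reaches_def)
    then obtain x where "x < 28" "snd y = e_gstate ! x" "reaches w (x, snd y)"
      by (rule reaches_cases)
    with w show "y \<in> (\<lambda>x. (x, e_gstate ! x)) ` {..<28}"
      by (cases y) (auto simp: reaches_def)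
  qed
  have short: "\<exists>w\<in>G. reaches w y \<and> length w \<le> 13" if "y \<in> (\<lambda>x. (x, e_gstate ! x)) ` {..<28}" for y
  proof -
    have "y \<in> set (pairs_within 13)"
      using that pairs_within_13 by (auto simp: Let_def list_all_iff List.member_iff)
    then obtain w where "length w \<le> 13" "reaches w y" using pairs_within_reaches by blast
    then show ?thesis by (auto simp: G_iff reaches_def)
  qed
  then have "(\<lambda>x. (x, e_gstate ! x)) ` {..<28} \<subseteq> reachable_pairs"
    unfolding reachable_pairs_def by blast
  then show "reachable_pairs = (\<lambda>x. (x, e_gstate ! x)) ` {..<28}" using sub by blast
  then show "y \<in> reachable_pairs \<Longrightarrow> \<exists>w\<in>G. reaches w y \<and> length w \<le> 13" using short by simp
qed

lemma prefix_choice_exists: "\<exists>pre. prefix_choice pre"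
  using short_prefix unfolding prefix_choice_def H_def by meson

section \<open>The tail estimate\<close>

lemma const_c_unique:
  fixes s t :: real
  assumes "s ^ 3 - s ^ 2 + 2 * s - 1 = 0" "t ^ 3 - t ^ 2 + 2 * t - 1 = 0"
  shows "s = t"
proof -
  have "(s - t) * (s\<^sup>2 + s * t + t\<^sup>2 - s - t + 2) = 0"
    using assms by (simp add: algebra_simps power2_eq_square power3_eq_cube)
  moreover have "s\<^sup>2 + s * t + t\<^sup>2 - s - t + 2 = ((s + t - 1)\<^sup>2 + s\<^sup>2 + t\<^sup>2 + 3) / 2"
    by (simp add: field_simps power2_eq_square)
  moreover have "(s + t - 1)\<^sup>2 + s\<^sup>2 + t\<^sup>2 + 3 > 0"
    by (intro add_nonneg_pos add_nonneg_nonneg) auto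
  ultimately show ?thesis by auto
qed

lemma const_c_root: "const_c ^ 3 - const_c ^ 2 + 2 * const_c - 1 = 0"
  and const_c_bounds: "5698 / 10000 \<le> const_c" "const_c \<le> 5699 / 10000"
proof -
  let ?h = "\<lambda>t :: real. t ^ 3 - t ^ 2 + 2 * t - 1"
  have h: "?h (5698 / 10000) \<le> 0" "0 \<le> ?h (5699 / 10000)"
    "continuous_on {5698 / 10000..5699 / 10000} ?h"
    by (simp_all add: power2_eq_square power3_eq_cube continuous_intros)
  obtain t :: real where t: "5698 / 10000 \<le> t" "t \<le> 5699 / 10000"
    "t ^ 3 - t ^ 2 + 2 * t - 1 = 0"
    using IVT'[OF h(1,2) _ h(3)] by auto
  have "const_c = t"
    unfolding const_c_def
    by (rule the_equality) (use t(3) const_c_unique[OF _ t(3)] in blast)+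
  then show "const_c ^ 3 - const_c ^ 2 + 2 * const_c - 1 = 0"
    "5698 / 10000 \<le> const_c" "const_c \<le> 5699 / 10000" using t by simp_all
qed

text \<open>What a one at place \<open>j\<close> contributes to \<open>f\<close>, apart from the
  output of \<open>E\<close>. It is used from \<open>j = 3\<close> on, beyond the truncated
  subtraction and the irregular \<open>U 0\<close>.\<close>

definition shift_error :: "nat \<Rightarrow> real" where
  "shift_error j = real (U (j - 2)) - const_c * real (U j)"

text \<open>On the plane containing the vectors of consecutive errors, the third-order recursion of
  \<open>U\<close> reduces to one of second order with complex characteristic roots.\<close>

lemma shift_error_rec:
  "shift_error (j + 5) = - (1 + const_c\<^sup>2) * shift_error (j + 4)
     - (1 - const_c + const_c\<^sup>2) * shift_error (j + 3)"
proof (induction j)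
  case 0
  have "U 5 = 7" by (simp add: numeral_eq_Suc)
  moreover have "U 4 = 5" "U 3 = 4" "U 2 = 3" "U 1 = 2" by (simp_all add: numeral_eq_Suc)
  ultimately have e: "shift_error 3 = 2 - 4 * const_c" "shift_error 4 = 3 - 5 * const_c"
    "shift_error 5 = 4 - 7 * const_c"
    by (simp_all add: shift_error_def)
  have "shift_error 5 + (1 + const_c\<^sup>2) * shift_error 4 + (1 - const_c + const_c\<^sup>2) * shift_error 3
      = - 9 * (const_c ^ 3 - const_c ^ 2 + 2 * const_c - 1)"
    unfolding e by (simp add: algebra_simps power2_eq_square power3_eq_cube)
  then show ?case using const_c_root by (simp add: algebra_simps)
next
  case (Suc j)
  have "U (j + 6) = U (j + 4) + U (j + 3)" "U (j + 4) = U (j + 2) + U (j + 1)"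
    by (simp_all add: numeral_eq_Suc)
  then have third: "shift_error (j + 6) = shift_error (j + 4) + shift_error (j + 3)"
    by (simp add: shift_error_def algebra_simps)
  \<comment> \<open>Here rho = 1 + c^2 and 1/rho = 1 - c + c^2 are the coefficients of the factor
    t^2 + rho t + 1/rho of t^3 - t - 1.\<close>
  have c: "(1 + const_c\<^sup>2) * (1 - const_c + const_c\<^sup>2) = 1" "(1 + const_c\<^sup>2)\<^sup>2 = 2 - const_c + const_c\<^sup>2"
    using const_c_root by algebra+
  show ?case using Suc third c
    by (simp add: eval_nat_numeral) algebra
qed

text \<open>This is |e(j+1) - z e(j)|^2 for the errors e and a complex root z of the quadratic
  recursion, hence a step multiplies it by |z|^2 = 1/rho.\<close>

definition error_form :: "nat \<Rightarrow> real" where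
  "error_form j = (shift_error (j + 1))\<^sup>2 + (1 + const_c\<^sup>2) * shift_error j * shift_error (j + 1)
     + (1 - const_c + const_c\<^sup>2) * (shift_error j)\<^sup>2"

lemma error_form_step:
  "error_form (j + 4) = (1 - const_c + const_c\<^sup>2) * error_form (j + 3)"
proof -
  have e: "j + 4 + 1 = j + 5" "j + 3 + 1 = j + 4" by simp_all
  show ?thesis unfolding error_form_def e using shift_error_rec[of j] by algebra
qed

lemma contraction_bounds: "0 \<le> 1 - const_c + const_c\<^sup>2" "1 - const_c + const_c\<^sup>2 \<le> (7 / 8)\<^sup>2"
  and const_c_sq_bounds: "3246 / 10000 \<le> const_c\<^sup>2" "const_c\<^sup>2 \<le> 3248 / 10000"
proof -
  have "(5698 / 10000)\<^sup>2 \<le> const_c\<^sup>2" "const_c\<^sup>2 \<le> (5699 / 10000)\<^sup>2"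
    using const_c_bounds by (intro power_mono; simp)+
  then show sq: "3246 / 10000 \<le> const_c\<^sup>2" "const_c\<^sup>2 \<le> 3248 / 10000"
    by (simp_all add: power2_eq_square)
  show "0 \<le> 1 - const_c + const_c\<^sup>2" "1 - const_c + const_c\<^sup>2 \<le> (7 / 8)\<^sup>2"
    using const_c_bounds sq by (simp_all add: power_divide)
qed

lemma error_form_3: "error_form 3 = 1 - 3 * const_c\<^sup>2"
proof -
  have "U 4 = 5" "U 3 = 4" "U 2 = 3" "U 1 = 2" by (simp_all add: numeral_eq_Suc)
  then have e: "shift_error 3 = 2 - 4 * const_c" "shift_error 4 = 3 - 5 * const_c"
    by (simp_all add: shift_error_def)
  show ?thesis unfolding error_form_def using const_c_root by (simp add: e) algebra
qed

lemma shift_error_le: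
  assumes "3 \<le> j"
  shows "\<bar>shift_error j\<bar> \<le> 5 / 16 * (7 / 8) ^ (j - 3)"
proof -
  have form: "error_form (i + 3) \<le> ((7 / 8)\<^sup>2) ^ i * (1 - 3 * const_c\<^sup>2)" for i
  proof (induction i)
    case 0
    show ?case by (simp add: error_form_3)
  next
    case (Suc i)
    have pos: "0 \<le> ((7 / 8)\<^sup>2) ^ i * (1 - 3 * const_c\<^sup>2)" using const_c_sq_bounds by simp
    have "error_form (Suc i + 3) = (1 - const_c + const_c\<^sup>2) * error_form (i + 3)"
      using error_form_step[of i] by (simp add: add.commute)
    also have "\<dots> \<le> (1 - const_c + const_c\<^sup>2) * (((7 / 8)\<^sup>2) ^ i * (1 - 3 * const_c\<^sup>2))"
      by (rule mult_left_mono[OF Suc contraction_bounds(1)])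
    also have "\<dots> \<le> (7 / 8)\<^sup>2 * (((7 / 8)\<^sup>2) ^ i * (1 - 3 * const_c\<^sup>2))"
      by (rule mult_right_mono[OF contraction_bounds(2) pos])
    finally show ?case by (simp add: mult.assoc)
  qed
  define i where "i = j - 3"
  have j: "j = i + 3" using assms by (simp add: i_def)
  \<comment> \<open>The coefficient 1/rho - rho^2/4 left after completing the square.\<close>
  let ?d = "(2 - 3 * const_c + 3 * const_c\<^sup>2) / 4"
  have d: "0 < ?d" using const_c_bounds const_c_sq_bounds by simp
  have "error_form j = (shift_error (j + 1) + (1 + const_c\<^sup>2) / 2 * shift_error j)\<^sup>2
      + ?d * (shift_error j)\<^sup>2"
  proof -
    have r: "(1 + const_c\<^sup>2)\<^sup>2 = 2 - const_c + const_c\<^sup>2" using const_c_root by algebra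
    have square: "(x + b / 2 * e)\<^sup>2 + d * e\<^sup>2 = x\<^sup>2 + b * e * x + (b\<^sup>2 / 4 + d) * e\<^sup>2"
      for x b d e :: real
      by (simp add: power2_eq_square field_simps)
    have "(2 - const_c + const_c\<^sup>2) / 4 + ?d = 1 - const_c + const_c\<^sup>2"
      by (simp add: field_simps)
    then show ?thesis unfolding square r error_form_def by simp
  qed
  then have "?d * (shift_error j)\<^sup>2 \<le> error_form j" by simp
  also have "\<dots> \<le> ((7 / 8)\<^sup>2) ^ i * (1 - 3 * const_c\<^sup>2)" using form j by simp
  \<comment> \<open>The constant 5/16 comes from here: its square bounds \<open>error_form 3\<close>
    divided by \<open>?d\<close>.\<close>
  also have "\<dots> \<le> ((7 / 8)\<^sup>2) ^ i * (?d * (5 / 16)\<^sup>2)"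
    using const_c_bounds const_c_sq_bounds
    by (intro mult_left_mono) (simp_all add: power_divide field_simps)
  also have "\<dots> = ?d * (5 / 16 * (7 / 8) ^ i)\<^sup>2"
  proof -
    have "((7 / 8)\<^sup>2) ^ i = ((7 / 8 :: real) ^ i)\<^sup>2" by (simp add: power_mult[symmetric] mult.commute)
    then show ?thesis unfolding power_mult_distrib by (simp only: mult_ac)
  qed
  finally have "(shift_error j)\<^sup>2 \<le> (5 / 16 * (7 / 8) ^ i)\<^sup>2"
    using d by (simp only: mult_le_cancel_left_pos)
  then have "\<bar>shift_error j\<bar>\<^sup>2 \<le> (5 / 16 * (7 / 8) ^ i)\<^sup>2" by simp
  then show ?thesis unfolding i_def by (rule power2_le_imp_le) simp
qed

text \<open>In state \<open>W\<^sub>j\<close> with \<open>j > 0\<close> the last one was read \<open>4 - j\<close> steps ago, in state \<open>W0\<close> at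
  least four steps ago.\<close>

fun weight :: "gstate \<Rightarrow> real" where
  "weight W0 = (7 / 8) ^ 4"
| "weight W1 = (7 / 8) ^ 3"
| "weight W2 = (7 / 8) ^ 2"
| "weight W3 = 7 / 8"
| "weight _ = 1"

text \<open>Ones five places apart give a geometric series of ratio (7/8)^5. Excluding
  \<open>Term\<close> excludes the exceptional one, which is only four places from its
  predecessor.\<close>

lemma tail_bound:
  assumes "run g_step W0 p = Some q" "q \<noteq> Term" "3 \<le> K"
  shows "\<bar>wsum (\<lambda>i. shift_error (i + K)) p\<bar> \<le> real_of_rat (R K)"
proof -
  let ?D = "1 / (1 - (7 / 8) ^ 5) :: real"
  have "\<bar>wsum (\<lambda>i. shift_error (i + K)) p\<bar> \<le> 5 / 16 * (7 / 8) ^ (K - 3) * (weight q * ?D)"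
    using assms
  proof (induction p arbitrary: q K rule: rev_induct)
    case Nil
    have "0 \<le> weight q" by (cases q) simp_all
    then have "0 \<le> 5 / 16 * (7 / 8) ^ (K - 3) * (weight q * ?D)"
      by (intro mult_nonneg_nonneg) (simp_all add: power_divide)
    then show ?case by (simp only: wsum_Nil abs_zero)
  next
    case (snoc d p)
    obtain q0 where q0: "run g_step W0 p = Some q0" "g_step q0 d = Some q"
      using snoc.prems(1) by (auto simp: run_snoc split: bind_splits)
    then have "q0 \<noteq> Term" by auto
    have K: "(7 / 8 :: real) ^ (Suc K - 3) = 7 / 8 * (7 / 8) ^ (K - 3)"
      using snoc.prems(3) by (simp only: Suc_diff_le power_Suc)
    let ?M = "5 / 16 * (7 / 8) ^ (K - 3) :: real"
    have "\<bar>wsum (\<lambda>i. shift_error (i + Suc K)) p\<bar> \<le> 7 / 8 * ?M * (weight q0 * ?D)"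
      using snoc.IH[OF q0(1) \<open>q0 \<noteq> Term\<close>, of "Suc K"] snoc.prems(3)
      unfolding K by (simp only: mult_ac)
    moreover have "\<bar>of_bool d * shift_error K\<bar> \<le> of_bool d * ?M"
      using shift_error_le[OF snoc.prems(3)] by simp
    moreover have "7 / 8 * ?M * (weight q0 * ?D) + of_bool d * ?M \<le> ?M * (weight q * ?D)"
    proof -
      \<comment> \<open>The step from \<open>W0\<close> to \<open>W4\<close> determines
        \<open>?D\<close>, by (7/8)^5 D + 1 = D.\<close>
      have "7 / 8 * (weight q0 * ?D) + of_bool d \<le> weight q * ?D"
        using q0(2) snoc.prems(2) by (cases rule: g_step_cases) (simp_all add: power_divide)
      then have "?M * (7 / 8 * (weight q0 * ?D) + of_bool d) \<le> ?M * (weight q * ?D)"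
        by (intro mult_left_mono) simp_all
      then show ?thesis by (simp add: algebra_simps)
    qed
    ultimately show ?case by (simp add: wsum_snoc)
  qed
  also have "\<dots> \<le> 5 / 16 * (7 / 8) ^ (K - 3) * ?D"
  proof -
    have "weight q \<le> 1" by (cases q) (simp_all add: power_divide)
    then have "weight q * ?D \<le> ?D" by (simp add: power_divide)
    then show ?thesis by (rule mult_left_mono) simp
  qed
  also have "\<dots> = real_of_rat (R K)"
    by (simp add: R_def of_rat_divide of_rat_mult of_rat_power of_rat_diff)
  finally show ?thesis .
qed

section \<open>The enclosures\<close>

lemma seq_a_E_out:
  assumes "w \<in> G"
  shows "int (seq_a (val w)) =
    E_out w + (\<Sum>j\<in>{2..<length w}. of_bool (digit w j) * int (U (j - 2)))"
proof -
  obtain g where g: "run g_step W0 w = Some g" using assms by (auto simp: G_iff)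
  obtain n where n: "run e_step 0 w = Some (m_e n)" "e_gstate ! m_e n = g"
    using run_m[OF g] by blast
  show ?thesis
    using seq_a_place[OF g n(1)] last_digits(2)[OF g] n
    by (simp add: shifted_val_pad E_out_def e_corr_def place_def)
qed

text \<open>\<open>W\<close> and \<open>T\<close> are the contributions of the prefix to a and to
  the value, so \<open>f\<close> is A - cB plus the tail W - cT.\<close>

lemma split_digits:
  assumes "p @ s \<in> G" "5 \<le> length s"
  obtains W T :: real where
    "real (seq_a (val (p @ s))) = A_part p s + W"
    "real (val (p @ s)) = B_part s + T"
    "\<bar>W - const_c * T\<bar> \<le> real_of_rat (R (length s))"
    "B_part s < U (length s)" "0 \<le> T" "T \<le> U (length (p @ s))"
proof -
  let ?K = "length s"
  define h :: "nat \<Rightarrow> int" where "h j = (if 2 \<le> j then int (U (j - 2)) else 0)" for j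
  have sum_h: "(\<Sum>j\<in>{2..<length w}. of_bool (digit w j) * int (U (j - 2))) = wsum h w" for w
    unfolding wsum_def h_def by (rule sum.mono_neutral_cong_left) auto
  define W :: real where "W = wsum (\<lambda>i. real (U (i + ?K - 2))) p"
  define T where "T = wsum (\<lambda>i. U (i + ?K)) p"
  obtain g q where g: "run g_step W0 p = Some q" "run g_step q s = Some g"
    using assms(1) by (auto simp: G_iff run_append split: bind_splits)
  have q: "q \<noteq> Term" using g(2) assms(2) by (cases s) auto
  have "int (seq_a (val (p @ s))) = A_part p s + wsum (\<lambda>i. h (i + ?K)) p"
    using seq_a_E_out[OF assms(1)] unfolding A_part_def sum_h by (simp add: wsum_append)
  then have "real_of_int (int (seq_a (val (p @ s)))) = real_of_int (A_part p s + wsum (\<lambda>i. h (i + ?K)) p)"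
    by (simp only:)
  moreover have "real_of_int (wsum (\<lambda>i. h (i + ?K)) p) = W"
    using assms(2) unfolding wsum_of_int[symmetric] W_def h_def by (intro wsum_cong) simp
  ultimately have 1: "real (seq_a (val (p @ s))) = A_part p s + W" by simp
  have B: "B_part s = val s" by (simp add: B_part_def val_def atLeast0LessThan)
  have val: "val (p @ s) = B_part s + T"
    by (simp add: B T_def val_wsum wsum_append)
  have "W - const_c * T = wsum (\<lambda>i. shift_error (i + ?K)) p"
    unfolding W_def T_def shift_error_def wsum_diff wsum_scale wsum_of_nat ..
  then have 2: "\<bar>W - const_c * T\<bar> \<le> real_of_rat (R ?K)"
    using tail_bound[OF g(1) q, of ?K] assms(2) by simp
  show thesis
  proof (rule that[of W "real T"])
    show "real (seq_a (val (p @ s))) = A_part p s + W" by (fact 1)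
    show "real (val (p @ s)) = B_part s + real T" using val by simp
    show "\<bar>W - const_c * real T\<bar> \<le> real_of_rat (R ?K)" by (fact 2)
    show "B_part s < U ?K" using val_less_U[of q s] g(2) B by simp
    show "real T \<le> U (length (p @ s))"
      using val_less_U[of W0 "p @ s"] assms(1) val by (simp add: G_iff)
  qed simp
qed

lemma finite_legal_suffixes: "finite (legal_suffixes pre K)"
proof (rule finite_subset)
  show "legal_suffixes pre K \<subseteq> reachable_pairs \<times> {s. set s \<subseteq> UNIV \<and> length s = K}"
    by (auto simp: legal_suffixes_def)
  show "finite (reachable_pairs \<times> {s :: bool list. set s \<subseteq> UNIV \<and> length s = K})"
    by (intro finite_cartesian_product finite_lists_length_eq) (simp_all add: reachable_pairs_eq)
qed

lemma prefix_choiceD: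
  assumes "prefix_choice pre" "x \<in> reachable_pairs"
  shows "pre x \<in> G" "reaches (pre x) x" "length (pre x) \<le> 13"
  using assms by (auto simp: prefix_choice_def H_def)

text \<open>\<open>A_part\<close> sees a prefix only through the pair of states it reaches, so the
  fixed prefixes represent all of them.\<close>

lemma replace_prefix:
  assumes pre: "prefix_choice pre" and ps: "p @ s \<in> G"
  obtains x where "(x, s) \<in> legal_suffixes pre (length s)" "A_part (pre x) s = A_part p s"
proof -
  obtain g where g: "run g_step W0 p = Some g"
    using ps by (auto simp: G_iff run_append split: bind_splits)
  obtain x where x: "reaches p (x, g)" using reaches_cases[OF g] by blast
  then have mem: "(x, g) \<in> reachable_pairs"
    using g by (auto simp: reachable_pairs_def G_iff)
  note px = prefix_choiceD(2)[OF pre mem]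
  have "run e_step 0 (pre (x, g) @ s) = run e_step 0 (p @ s)"
    "run g_step W0 (pre (x, g) @ s) = run g_step W0 (p @ s)"
    using x px by (simp_all add: reaches_def run_append)
  then have "((x, g), s) \<in> legal_suffixes pre (length s)" "A_part (pre (x, g)) s = A_part p s"
    using ps mem by (simp_all add: legal_suffixes_def G_iff A_part_def E_out_def)
  then show thesis by (rule that)
qed

lemma legal_suffixes_nonempty:
  assumes "prefix_choice pre"
  shows "legal_suffixes pre K \<noteq> {}"
proof -
  have "[] @ replicate K False \<in> G"
    using run_replicate_False[of K "[]"] by (simp add: G_iff)
  then show ?thesis using replace_prefix[OF assms] by (metis empty_iff length_replicate)
qed

lemma f_enclosed:
  assumes pre: "prefix_choice pre" and K: "5 \<le> K" and br: "bracket \<alpha> \<beta>"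
  shows "real_of_rat (L pre K \<beta> - R K) \<le> f n" "f n \<le> real_of_rat (V pre K \<alpha> + R K)"
proof -
  \<comment> \<open>Any length above \<open>n\<close> can represent \<open>n\<close>; this one
    leaves exactly \<open>K\<close> digits after a prefix of \<open>n + 1\<close>.\<close>
  obtain w where w: "length w = n + K + 1" "run g_step W0 w \<noteq> None" "val w = n"
    using legal_word_exists[of n "n + K + 1"] by auto
  define p s where "p = take (n + 1) w" and "s = drop (n + 1) w"
  have ps: "p @ s = w" "length s = K" using w(1) by (simp_all add: p_def s_def)
  then have G: "p @ s \<in> G" using w(2) by (simp add: G_iff)
  obtain W T :: real where WT: "real (seq_a (val (p @ s))) = A_part p s + W"
    "real (val (p @ s)) = B_part s + T" "\<bar>W - const_c * T\<bar> \<le> real_of_rat (R (length s))"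
    by (rule split_digits[OF G]) (use K ps in auto)
  obtain x where x: "(x, s) \<in> legal_suffixes pre (length s)" "A_part (pre x) s = A_part p s"
    by (rule replace_prefix[OF pre G])
  have con: "real_of_rat (contribution pre \<gamma> (x, s)) = A_part p s - real_of_rat \<gamma> * B_part s" for \<gamma>
    using x(2) by (simp add: contribution_def of_rat_diff of_rat_mult)
  have fn: "f n = A_part p s - const_c * B_part s + (W - const_c * T)"
    using WT(1,2) ps w(3) by (simp add: f_def algebra_simps)
  have ab: "real_of_rat \<alpha> * B_part s \<le> const_c * B_part s" "const_c * B_part s \<le> real_of_rat \<beta> * B_part s"
    using br by (auto simp: bracket_def intro!: mult_right_mono)
  have "L pre K \<beta> \<le> contribution pre \<beta> (x, s)" "contribution pre \<alpha> (x, s) \<le> V pre K \<alpha>"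
    using x(1) ps(2) finite_legal_suffixes unfolding L_def V_def by (auto intro!: Min_le Max_ge)
  then have "real_of_rat (L pre K \<beta>) \<le> A_part p s - real_of_rat \<beta> * B_part s"
    "A_part p s - real_of_rat \<alpha> * B_part s \<le> real_of_rat (V pre K \<alpha>)"
    by (simp_all only: con[symmetric] of_rat_less_eq)
  then show "real_of_rat (L pre K \<beta> - R K) \<le> f n" "f n \<le> real_of_rat (V pre K \<alpha> + R K)"
    using WT(3) fn ab ps(2) by (simp_all add: of_rat_diff of_rat_add)
qed

lemma attains_exist:
  assumes "prefix_choice pre"
  shows "\<exists>y. attains_L pre K \<beta> y" "\<exists>y. attains_V pre K \<alpha> y"
proof -
  let ?C = "\<lambda>\<gamma>. contribution pre \<gamma> ` legal_suffixes pre K"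
  have fin: "finite (?C \<gamma>)" "?C \<gamma> \<noteq> {}" for \<gamma>
    using finite_legal_suffixes legal_suffixes_nonempty[OF assms] by auto
  show "\<exists>y. attains_L pre K \<beta> y"
    using Min_in[OF fin(1)[of \<beta>] fin(2)] unfolding attains_L_def L_def by (metis imageE)
  show "\<exists>y. attains_V pre K \<alpha> y"
    using Max_in[OF fin(1)[of \<alpha>] fin(2)] unfolding attains_V_def V_def by (metis imageE)
qed

lemma attained_word:
  assumes pre: "prefix_choice pre" and K: "5 \<le> K" and y: "(x, s) \<in> legal_suffixes pre K"
  obtains W T :: real where
    "real (seq_a (n_of pre (x, s))) = A_part (pre x) s + W"
    "real (n_of pre (x, s)) = B_part s + T"
    "\<bar>W - const_c * T\<bar> \<le> real_of_rat (R K)"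
    "B_part s \<le> U K" "0 \<le> T" "T \<le> U (K + H)"
proof -
  have mem: "x \<in> reachable_pairs" "length s = K" "pre x @ s \<in> G"
    using y by (auto simp: legal_suffixes_def)
  obtain W T :: real where WT: "real (seq_a (val (pre x @ s))) = A_part (pre x) s + W"
    "real (val (pre x @ s)) = B_part s + T" "\<bar>W - const_c * T\<bar> \<le> real_of_rat (R (length s))"
    "B_part s < U (length s)" "0 \<le> T" "T \<le> U (length (pre x @ s))"
    by (rule split_digits[OF mem(3)]) (use K mem in auto)
  have "U (length (pre x @ s)) \<le> U (K + H)"
    using prefix_choiceD(3)[OF pre mem(1)] mem(2)
    by (simp add: strict_mono_less_eq[OF U_strict_mono] H_def)
  then have "T \<le> U (K + H)" using WT(6) by linarith
  then show thesis using that[of W T] WT mem(2) by (simp add: n_of_def)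
qed

lemma width_of_rat:
  "real_of_rat (width_bound K \<alpha> \<beta>) = 2 * real_of_rat (R K)
     + (real_of_rat \<beta> - real_of_rat \<alpha>) * (U K + U (K + H))"
  by (simp add: width_bound_def of_rat_add of_rat_mult of_rat_diff)

lemma f_at_attained:
  assumes "bracket \<alpha> \<beta>"
  shows "f (n_of pre y) \<le> real_of_rat (u_minus pre \<alpha> y)"
    and "real_of_rat (l_plus pre \<beta> y) \<le> f (n_of pre y)"
  using assms
  by (auto simp: f_def u_minus_def l_plus_def bracket_def of_rat_diff of_rat_mult intro!: mult_right_mono)

text \<open>At an attaining word the width is the tail, at most R in absolute value, plus the added
  R, plus the rounding errors of the bracket on T and B.\<close>

lemma enclosure_width:
  assumes pre: "prefix_choice pre" and K: "5 \<le> K" and br: "bracket \<alpha> \<beta>"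
  shows "attains_L pre K \<beta> y \<Longrightarrow> u_minus pre \<alpha> y - (L pre K \<beta> - R K) \<le> width_bound K \<alpha> \<beta>"
    and "attains_V pre K \<alpha> y \<Longrightarrow> V pre K \<alpha> + R K - l_plus pre \<beta> y \<le> width_bound K \<alpha> \<beta>"
proof -
  obtain x s where y: "y = (x, s)" by (cases y)
  let ?a = "real_of_rat \<alpha>" and ?b = "real_of_rat \<beta>" and ?B = "real (B_part s)"
  have ab: "?a < const_c" "const_c < ?b" using br by (auto simp: bracket_def)
  have con: "real_of_rat (contribution pre \<gamma> y) = A_part (pre x) s - real_of_rat \<gamma> * ?B" for \<gamma>
    by (simp add: y contribution_def of_rat_diff of_rat_mult)
  have ends: "real_of_rat (u_minus pre \<alpha> y) = seq_a (n_of pre y) - ?a * n_of pre y"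
    "real_of_rat (l_plus pre \<beta> y) = seq_a (n_of pre y) - ?b * n_of pre y"
    by (simp_all add: u_minus_def l_plus_def of_rat_diff of_rat_mult)
  have width: "(const_c - ?a) * T + (?b - ?a) * ?B \<le> (?b - ?a) * (U K + U (K + H))"
    "(?b - const_c) * T + (?b - ?a) * ?B \<le> (?b - ?a) * (U K + U (K + H))"
    if "B_part s \<le> U K" "0 \<le> T" "T \<le> U (K + H)" for T :: real
  proof -
    have "(const_c - ?a) * T \<le> (?b - ?a) * U (K + H)" "(?b - const_c) * T \<le> (?b - ?a) * U (K + H)"
      using ab that by (intro mult_mono; simp)+
    moreover have "(?b - ?a) * ?B \<le> (?b - ?a) * U K"
      using ab that by (intro mult_left_mono) simp_all
    ultimately show "(const_c - ?a) * T + (?b - ?a) * ?B \<le> (?b - ?a) * (U K + U (K + H))"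
      "(?b - const_c) * T + (?b - ?a) * ?B \<le> (?b - ?a) * (U K + U (K + H))"
      by (simp_all add: algebra_simps)
  qed
  show "u_minus pre \<alpha> y - (L pre K \<beta> - R K) \<le> width_bound K \<alpha> \<beta>" if L: "attains_L pre K \<beta> y"
  proof -
    have mem: "(x, s) \<in> legal_suffixes pre K" and Leq: "L pre K \<beta> = contribution pre \<beta> y"
      using L by (auto simp: attains_L_def y)
    obtain W T :: real where WT: "real (seq_a (n_of pre (x, s))) = A_part (pre x) s + W"
      "real (n_of pre (x, s)) = ?B + T" "\<bar>W - const_c * T\<bar> \<le> real_of_rat (R K)"
      "B_part s \<le> U K" "0 \<le> T" "T \<le> U (K + H)"
      by (rule attained_word[OF pre K mem])
    have "real_of_rat (u_minus pre \<alpha> y - (L pre K \<beta> - R K)) =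
      W - const_c * T + ((const_c - ?a) * T + (?b - ?a) * ?B) + real_of_rat (R K)"
      unfolding of_rat_diff Leq con ends using WT(1,2) by (simp add: y[symmetric] algebra_simps)
    also have "\<dots> \<le> real_of_rat (width_bound K \<alpha> \<beta>)"
      using WT(3) width(1)[OF WT(4-6)] unfolding width_of_rat by linarith
    finally show ?thesis by (simp only: of_rat_less_eq)
  qed
  show "V pre K \<alpha> + R K - l_plus pre \<beta> y \<le> width_bound K \<alpha> \<beta>" if V: "attains_V pre K \<alpha> y"
  proof -
    have mem: "(x, s) \<in> legal_suffixes pre K" and Veq: "V pre K \<alpha> = contribution pre \<alpha> y"
      using V by (auto simp: attains_V_def y)
    obtain W T :: real where WT: "real (seq_a (n_of pre (x, s))) = A_part (pre x) s + W"
      "real (n_of pre (x, s)) = ?B + T" "\<bar>W - const_c * T\<bar> \<le> real_of_rat (R K)"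
      "B_part s \<le> U K" "0 \<le> T" "T \<le> U (K + H)"
      by (rule attained_word[OF pre K mem])
    have "real_of_rat (V pre K \<alpha> + R K - l_plus pre \<beta> y) =
      - (W - const_c * T) + ((?b - const_c) * T + (?b - ?a) * ?B) + real_of_rat (R K)"
      unfolding of_rat_diff of_rat_add Veq con ends using WT(1,2)
      by (simp add: y[symmetric] algebra_simps)
    also have "\<dots> \<le> real_of_rat (width_bound K \<alpha> \<beta>)"
      using WT(3) width(2)[OF WT(4-6)] unfolding width_of_rat by linarith
    finally show ?thesis by (simp only: of_rat_less_eq)
  qed
qed

section \<open>Brackets of prescribed width and convergence\<close>

lemma bracket_exists:
  assumes "0 < (\<delta> :: rat)"
  shows "\<exists>\<alpha> \<beta>. bracket \<alpha> \<beta> \<and> \<beta> - \<alpha> = \<delta>"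
proof -
  have "const_c - real_of_rat \<delta> < const_c" using assms by simp
  then obtain \<alpha> where "const_c - real_of_rat \<delta> < real_of_rat \<alpha>" "real_of_rat \<alpha> < const_c"
    using of_rat_dense by blast
  then have "bracket \<alpha> (\<alpha> + \<delta>)" by (simp add: bracket_def of_rat_add)
  then show ?thesis by (intro exI[of _ \<alpha>] exI[of _ "\<alpha> + \<delta>"]) simp
qed

lemma U_le_power: "U p \<le> 2 ^ p"
proof (induction p rule: U.induct)
  case (5 p)
  then have "U (Suc (Suc (Suc (Suc p)))) \<le> 2 ^ Suc (Suc p) + 2 ^ Suc p" by simp
  then show ?case by simp
qed simp_all

lemma width_bound_tendsto:
  "(\<lambda>K. 2 * real_of_rat (R K) + 1 / 2 ^ (4 * K + 64) * (U K + U (K + H))) \<longlonglongrightarrow> 0"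
proof -
  have "(\<lambda>K. real_of_rat (R (K + 3))) \<longlonglongrightarrow> 0"
  proof -
    have "(\<lambda>K. 5 / 16 * (7 / 8) ^ K / (1 - (7 / 8) ^ 5) :: real) \<longlonglongrightarrow> 5 / 16 * 0 / (1 - (7 / 8) ^ 5)"
      by (intro tendsto_intros LIMSEQ_power_zero) (simp_all add: power_divide)
    then show ?thesis by (simp add: R_def of_rat_divide of_rat_mult of_rat_power of_rat_diff)
  qed
  then have R: "(\<lambda>K. real_of_rat (R K)) \<longlonglongrightarrow> 0" by (rule LIMSEQ_offset)
  have "(\<lambda>K. 1 / 2 ^ (4 * K + 64) * real (U K + U (K + H))) \<longlonglongrightarrow> 0"
  proof (rule tendsto_sandwich)
    show "\<forall>\<^sub>F K in sequentially. 1 / 2 ^ (4 * K + 64) * real (U K + U (K + H)) \<le> (1 / 2) ^ K"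
    proof (intro always_eventually allI)
      fix K
      have "U K + U (K + H) \<le> 2 ^ K + 2 ^ (K + 13)"
        using U_le_power[of K] U_le_power[of "K + 13"] by (simp add: H_def)
      also have "\<dots> \<le> 2 ^ K * 2 ^ 14" by (simp add: power_add)
      also have "\<dots> \<le> 2 ^ K * 2 ^ (2 * K + 64)" by (intro mult_left_mono power_increasing) simp_all
      finally have "real (U K + U (K + H)) \<le> real (2 ^ K * 2 ^ (2 * K + 64))" by (simp only: of_nat_le_iff)
      then have "1 / 2 ^ (4 * K + 64) * real (U K + U (K + H)) \<le>
        1 / 2 ^ (4 * K + 64) * (2 ^ K * 2 ^ (2 * K + 64))"
        by (intro mult_left_mono) simp_all
      also have "\<dots> = (1 / 2) ^ K"
      proof -
        have "(2::real) ^ (4 * K + 64) = 2 ^ K * 2 ^ (2 * K + 64) * 2 ^ K"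
          by (simp only: power_add[symmetric]) (rule arg_cong[of _ _ "(^) 2"], simp)
        then show ?thesis by (simp add: power_divide)
      qed
      finally show "1 / 2 ^ (4 * K + 64) * real (U K + U (K + H)) \<le> (1 / 2) ^ K" .
    qed
  qed (auto intro!: LIMSEQ_power_zero)
  from tendsto_add[OF tendsto_mult_right_zero[OF R, of 2] this] show ?thesis by simp
qed

theorem proposition4p2:
  shows
    "bdd_below (range f) \<and> bdd_above (range f) \<and>
     (\<exists>pre. prefix_choice pre) \<and>
     (\<forall>pre. prefix_choice pre \<longrightarrow>
        (\<forall>(K::nat) (\<alpha>::rat) (\<beta>::rat). K \<ge> 5 \<and> bracket \<alpha> \<beta> \<longrightarrow>
           (\<exists>y. attains_L pre K \<beta> y) \<and> (\<exists>y. attains_V pre K \<alpha> y) \<and>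
           (\<forall>y. attains_L pre K \<beta> y \<longrightarrow>
              real_of_rat (L pre K \<beta> - R K) \<le> (INF n. f n) \<and>
              (INF n. f n) \<le> real_of_rat (u_minus pre \<alpha> y) \<and>
              u_minus pre \<alpha> y - (L pre K \<beta> - R K) \<le> width_bound K \<alpha> \<beta>) \<and>
           (\<forall>y. attains_V pre K \<alpha> y \<longrightarrow>
              real_of_rat (l_plus pre \<beta> y) \<le> (SUP n. f n) \<and>
              (SUP n. f n) \<le> real_of_rat (V pre K \<alpha> + R K) \<and>
              (V pre K \<alpha> + R K) - l_plus pre \<beta> y \<le> width_bound K \<alpha> \<beta>)) \<and>
        (\<forall>K. \<exists>\<alpha> \<beta>. bracket \<alpha> \<beta> \<and> \<beta> - \<alpha> = 1 / 2 ^ (4 * K + 64)) \<and>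
        (\<forall>(\<alpha>::nat \<Rightarrow> rat) (\<beta>::nat \<Rightarrow> rat) y z.
           (\<forall>K\<ge>5. bracket (\<alpha> K) (\<beta> K) \<and> \<beta> K - \<alpha> K = 1 / 2 ^ (4 * K + 64) \<and>
              attains_L pre K (\<beta> K) (y K) \<and> attains_V pre K (\<alpha> K) (z K)) \<longrightarrow>
           (\<lambda>K. real_of_rat (u_minus pre (\<alpha> K) (y K) - (L pre K (\<beta> K) - R K)))
             \<longlonglongrightarrow> 0 \<and>
           (\<lambda>K. real_of_rat ((V pre K (\<alpha> K) + R K) - l_plus pre (\<beta> K) (z K)))
             \<longlonglongrightarrow> 0))"
proof -
  obtain pre0 where pre0: "prefix_choice pre0" using prefix_choice_exists by blast
  obtain \<alpha>0 \<beta>0 where br0: "bracket \<alpha>0 \<beta>0" using bracket_exists[of 1] by auto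
  \<comment> \<open>One enclosure, with \<open>K = 5\<close> and any bracket, already bounds
    \<open>f\<close> on both sides.\<close>
  have below: "bdd_below (range f)" and above: "bdd_above (range f)"
    using f_enclosed[OF pre0 order.refl br0] unfolding bdd_below_def bdd_above_def by blast+
  have inf: "real_of_rat (L pre K \<beta> - R K) \<le> (INF n. f n) \<and>
      (INF n. f n) \<le> real_of_rat (u_minus pre \<alpha> y)"
    and sup: "real_of_rat (l_plus pre \<beta> y) \<le> (SUP n. f n) \<and>
      (SUP n. f n) \<le> real_of_rat (V pre K \<alpha> + R K)"
    if "prefix_choice pre" "5 \<le> K" "bracket \<alpha> \<beta>" for pre K \<alpha> \<beta> y
    using f_enclosed[OF that] f_at_attained[OF that(3), of pre y]
      cINF_lower[OF below, of "n_of pre y"] cSUP_upper[OF _ above, of "n_of pre y"]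
    by (auto intro: cINF_greatest cSUP_least)
  have lim: "(\<lambda>K. real_of_rat (u_minus pre (\<alpha> K) (y K) - (L pre K (\<beta> K) - R K))) \<longlonglongrightarrow> 0 \<and>
      (\<lambda>K. real_of_rat ((V pre K (\<alpha> K) + R K) - l_plus pre (\<beta> K) (z K))) \<longlonglongrightarrow> 0"
    if pre: "prefix_choice pre"
      and a: "\<forall>K\<ge>5. bracket (\<alpha> K) (\<beta> K) \<and> \<beta> K - \<alpha> K = 1 / 2 ^ (4 * K + 64) \<and>
        attains_L pre K (\<beta> K) (y K) \<and> attains_V pre K (\<alpha> K) (z K)" for pre \<alpha> \<beta> y z
  proof -
    let ?w = "\<lambda>K. 2 * real_of_rat (R K) + 1 / 2 ^ (4 * K + 64) * (U K + U (K + H))"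
    have bounds: "0 \<le> real_of_rat (u_minus pre (\<alpha> K) (y K) - (L pre K (\<beta> K) - R K))"
      "real_of_rat (u_minus pre (\<alpha> K) (y K) - (L pre K (\<beta> K) - R K)) \<le> ?w K"
      "0 \<le> real_of_rat ((V pre K (\<alpha> K) + R K) - l_plus pre (\<beta> K) (z K))"
      "real_of_rat ((V pre K (\<alpha> K) + R K) - l_plus pre (\<beta> K) (z K)) \<le> ?w K" if K: "5 \<le> K" for K
    proof -
      have br: "bracket (\<alpha> K) (\<beta> K)" and d: "\<beta> K - \<alpha> K = 1 / 2 ^ (4 * K + 64)"
        and at: "attains_L pre K (\<beta> K) (y K)" "attains_V pre K (\<alpha> K) (z K)" using a K by auto
      have "real_of_rat (\<beta> K) - real_of_rat (\<alpha> K) = 1 / 2 ^ (4 * K + 64)"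
        unfolding of_rat_diff[symmetric] d by (simp add: of_rat_divide of_rat_power)
      then have w: "real_of_rat (width_bound K (\<alpha> K) (\<beta> K)) = ?w K"
        unfolding width_of_rat by simp
      \<comment> \<open>Widths are nonnegative because the infimum or supremum lies between the two
        endpoints.\<close>
      show "0 \<le> real_of_rat (u_minus pre (\<alpha> K) (y K) - (L pre K (\<beta> K) - R K))"
        using inf[OF pre K br, of "y K"] unfolding of_rat_diff[of "u_minus _ _ _"] by linarith
      show "0 \<le> real_of_rat ((V pre K (\<alpha> K) + R K) - l_plus pre (\<beta> K) (z K))"
        using sup[OF pre K br, of "z K"] unfolding of_rat_diff by linarith
      show "real_of_rat (u_minus pre (\<alpha> K) (y K) - (L pre K (\<beta> K) - R K)) \<le> ?w K"
        "real_of_rat ((V pre K (\<alpha> K) + R K) - l_plus pre (\<beta> K) (z K)) \<le> ?w K"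
        unfolding w[symmetric] of_rat_less_eq
        using enclosure_width(1)[OF pre K br at(1)] enclosure_width(2)[OF pre K br at(2)] by auto
    qed
    then show ?thesis
      by (intro conjI; intro tendsto_sandwich[OF _ _ tendsto_const width_bound_tendsto];
          intro eventually_sequentiallyI[of 5]; blast)
  qed
  have br: "\<exists>\<alpha> \<beta>. bracket \<alpha> \<beta> \<and> \<beta> - \<alpha> = 1 / 2 ^ (4 * K + 64)" for K
    by (rule bracket_exists) simp
  have enc: "(\<exists>y. attains_L pre K \<beta> y) \<and> (\<exists>y. attains_V pre K \<alpha> y) \<and>
      (\<forall>y. attains_L pre K \<beta> y \<longrightarrow>
         real_of_rat (L pre K \<beta> - R K) \<le> (INF n. f n) \<and>
         (INF n. f n) \<le> real_of_rat (u_minus pre \<alpha> y) \<and>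
         u_minus pre \<alpha> y - (L pre K \<beta> - R K) \<le> width_bound K \<alpha> \<beta>) \<and>
      (\<forall>y. attains_V pre K \<alpha> y \<longrightarrow>
         real_of_rat (l_plus pre \<beta> y) \<le> (SUP n. f n) \<and>
         (SUP n. f n) \<le> real_of_rat (V pre K \<alpha> + R K) \<and>
         (V pre K \<alpha> + R K) - l_plus pre \<beta> y \<le> width_bound K \<alpha> \<beta>)"
    if "prefix_choice pre" "5 \<le> K" "bracket \<alpha> \<beta>" for pre K \<alpha> \<beta>
    using attains_exist[OF that(1)] inf[OF that] sup[OF that] enclosure_width[OF that] by simp
  show ?thesis
  proof (intro conjI below above prefix_choice_exists, intro allI impI, intro conjI)
    fix pre assume pre: "prefix_choice pre"
    show "\<forall>K \<alpha> \<beta>. 5 \<le> K \<and> bracket \<alpha> \<beta> \<longrightarrow>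
           (\<exists>y. attains_L pre K \<beta> y) \<and> (\<exists>y. attains_V pre K \<alpha> y) \<and>
           (\<forall>y. attains_L pre K \<beta> y \<longrightarrow>
              real_of_rat (L pre K \<beta> - R K) \<le> (INF n. f n) \<and>
              (INF n. f n) \<le> real_of_rat (u_minus pre \<alpha> y) \<and>
              u_minus pre \<alpha> y - (L pre K \<beta> - R K) \<le> width_bound K \<alpha> \<beta>) \<and>
           (\<forall>y. attains_V pre K \<alpha> y \<longrightarrow>
              real_of_rat (l_plus pre \<beta> y) \<le> (SUP n. f n) \<and>
              (SUP n. f n) \<le> real_of_rat (V pre K \<alpha> + R K) \<and>
              (V pre K \<alpha> + R K) - l_plus pre \<beta> y \<le> width_bound K \<alpha> \<beta>)"
      by (intro allI impI, elim conjE, rule enc[OF pre])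
  qed (intro allI br, intro allI impI, rule lim)
qed

end
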